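(* Let $p = p(n)$ satisfy $p = \omega(\sqrt{\log n}/n)$ and $p \le \frac12 \log n / n$. Let $\tilde G$ be the largest connected component of the Erdős–Rényi random graph $G(n,p)$. Then with high probability $$\lambda(\tilde G) \ge \tfrac12 .$$
   Context: $G(n,p)$ is the random graph on $n$ vertices in which each edge is included independently with probability $p$. "With high probability" means with probability tending to $1$ as $n\to\infty$. $f=\omega(g)$ means $g/f \to 0$ as $n\to\infty$. The largest component is well-defined with high probability when $p=\omega(1/n)$. For a finite graph $G$ with adjacency matrix $A$ and diagonal degree matrix $T$, the normalized Laplacian is $L = \pi_+ - T^{-1/2} A T^{-1/2}$, where $\pi_+$ is the coordinate projection onto the vertices of positive degree and $T^{-1/2}$ is taken to be $0$ in coordinates where the degree is $0$. Its eigenvalues (with multiplicity) are $0=\lambda_1 \le \lambda_2 \le \dots \le \lambda_{|V(G)|} \le 2$. Define $\lambda(G) = \max_{i\neq 1} |1-\lambda_i|$. *)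

theory Defs
  imports
    "HOL-Probability.Product_PMF"
    "HOL-Library.Landau_Symbols"
    "Jordan_Normal_Form.Char_Poly"
    "Graph_Theory.Graph_Theory"
begin

text \<open>
  Finite simple graphs are the finite loopless symmetric digraphs of the locale
  \<^locale>\<open>pair_graph\<close>: the undirected edge \<open>{u, v}\<close> is the pair of arcs \<open>(u, v)\<close>, \<open>(v, u)\<close>.
  Hence out-degree is degree.
\<close>

definition possible_edges :: "nat \<Rightarrow> nat set set" where
  "possible_edges n = {e. e \<subseteq> {..<n} \<and> card e = 2}"

definition graph_of_edges :: "nat \<Rightarrow> nat set set \<Rightarrow> nat pair_pre_digraph" where
  "graph_of_edges n E = \<lparr> pverts = {..<n}, parcs = {(u, v). u \<noteq> v \<and> {u, v} \<in> E} \<rparr>"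

definition gnp :: "nat \<Rightarrow> real \<Rightarrow> nat pair_pre_digraph pmf" where
  "gnp n p =
     map_pmf (\<lambda>f. graph_of_edges n {e \<in> possible_edges n. f e})
       (Pi_pmf (possible_edges n) False (\<lambda>_. bernoulli_pmf p))"

lemma pair_graph_gnp:
  assumes "G \<in> set_pmf (gnp n p)"
  shows "pair_graph G"
proof -
  obtain f where G: "G = graph_of_edges n {e \<in> possible_edges n. f e}"
    using assms by (auto simp: gnp_def)
  have sub: "parcs G \<subseteq> {..<n} \<times> {..<n}"
    by (auto simp: G graph_of_edges_def possible_edges_def)
  have "finite (parcs G)"
    by (rule finite_subset[OF sub]) auto
  moreover have "sym (parcs G)"
    by (auto simp: sym_def G graph_of_edges_def insert_commute)
  ultimately show ?thesis
    using sub by unfold_locales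
      (auto simp: G graph_of_edges_def possible_edges_def symmetric_def)
qed

text \<open>Size is number of vertices. Uniqueness is not part of the definition.\<close>

definition largest_component :: "('a, 'b) pre_digraph \<Rightarrow> ('a, 'b) pre_digraph \<Rightarrow> bool" where
  "largest_component G H \<longleftrightarrow>
     pre_digraph.max_subgraph G connected H \<and>
     (\<forall>H'. pre_digraph.max_subgraph G connected H' \<longrightarrow> card (verts H') \<le> card (verts H))"

text \<open>
  Matrices are indexed by \<open>0, \<dots>, |V(G)| - 1\<close>, so the vertices are listed in increasing order;
  another order would conjugate the Laplacian by a permutation matrix and leave its
  spectrum unchanged.
\<close>

definition vertex :: "('a :: linorder, 'b) pre_digraph \<Rightarrow> nat \<Rightarrow> 'a" where
  "vertex G i = sorted_list_of_set (verts G) ! i"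

definition adjacency_matrix :: "('a :: linorder, 'b) pre_digraph \<Rightarrow> real mat" where
  "adjacency_matrix G =
     Matrix.mat (card (verts G)) (card (verts G))
       (\<lambda>(i, j). if vertex G i \<rightarrow>\<^bsub>G\<^esub> vertex G j then 1 else 0)"

definition inv_sqrt_degree_matrix :: "('a :: linorder, 'b) pre_digraph \<Rightarrow> real mat" where
  "inv_sqrt_degree_matrix G =
     mat_diag (card (verts G))
       (\<lambda>i. if out_degree G (vertex G i) = 0 then 0
            else 1 / sqrt (real (out_degree G (vertex G i))))"

definition positive_degree_projection :: "('a :: linorder, 'b) pre_digraph \<Rightarrow> real mat" where
  "positive_degree_projection G =
     mat_diag (card (verts G)) (\<lambda>i. if out_degree G (vertex G i) > 0 then 1 else 0)"

definition normalized_laplacian :: "('a :: linorder, 'b) pre_digraph \<Rightarrow> real mat" where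
  "normalized_laplacian G =
     positive_degree_projection G
       - inv_sqrt_degree_matrix G * adjacency_matrix G * inv_sqrt_degree_matrix G"

text \<open>
  The Laplacian of an undirected graph is a real symmetric matrix, so the real roots of its
  characteristic polynomial, with multiplicity, are all its eigenvalues. The list is increasing
  and 0-based: entry \<open>i\<close> is \<open>\<lambda>\<^bsub>i+1\<^esub>\<close>.
\<close>

definition laplacian_eigenvalues :: "('a :: linorder, 'b) pre_digraph \<Rightarrow> real list" where
  "laplacian_eigenvalues G = sorted_list_of_multiset (proots (char_poly (normalized_laplacian G)))"

text \<open>Unspecified (maximum of the empty set) for graphs with at most one vertex.\<close>

definition spectral_lambda :: "('a :: linorder, 'b) pre_digraph \<Rightarrow> real" where
  "spectral_lambda G =
     Max {\<bar>1 - laplacian_eigenvalues G ! i\<bar> | i. 1 \<le> i \<and> i < length (laplacian_eigenvalues G)}"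

end

theory Submission
  imports Defs "HOL-Real_Asymp.Real_Asymp"
begin

text \<open>
  Call a path \<open>v - u - w\<close> pendant if \<open>v\<close> is a leaf and \<open>u\<close> has degree 2. In the normalized
  Laplacian, the entry between \<open>v\<close> and \<open>u\<close> is then \<open>- 1 / sqrt 2\<close>, so the test vector
  \<open>e\<^sub>v - e\<^sub>u\<close> has Rayleigh quotient \<open>1 + 1 / sqrt 2\<close> and \<open>e\<^sub>v + e\<^sub>u\<close> has Rayleigh quotient
  \<open>1 - 1 / sqrt 2\<close>. Hence one eigenvalue is at least \<open>1 + 1 / sqrt 2 \<ge> 3 / 2\<close> and another
  one is smaller, and a graph that contains a pendant path has \<open>\<lambda> \<ge> 1 / 2\<close>
  (\<open>spectral_lambda_ge_half_if_pendant\<close>). It remains to find a pendant path in the largest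
  component.

  The expected number of pendant paths is \<open>\<mu> = n (n - 1) (n - 2) p\<^sup>2 (1 - p)\<^bsup>2 n - 5\<^esup>\<close>, which is
  of order \<open>n (n p)\<^sup>2 exp (- 2 n p)\<close>. The condition \<open>p \<le> 1/2 log n / n\<close> says exactly that
  \<open>exp (- 2 n p) \<ge> 1 / n\<close>, so \<open>\<mu>\<close> is at least of order \<open>(n p)\<^sup>2\<close> and tends to infinity. Two
  pendant paths that are far enough apart (\<open>separated\<close>) are almost independent, and all but at
  most three pendant paths are separated from a given one; so the second moment is
  \<open>(1 + o(1)) \<mu>\<^sup>2\<close> and the number of pendant paths is at least \<open>\<mu> / 2\<close> with high probability.

  Whether \<open>v - u - w\<close> is pendant depends only on the edges at \<open>v\<close> and \<open>u\<close>, hence is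
  independent of the graph induced on the other vertices. In that graph \<open>w\<close> rarely lies in a set
  of at most \<open>n / 2\<close> vertices that no edge leaves: since \<open>n p\<close> tends to infinity, a union bound over
  all \<open>2\<^sup>n\<close> sets excludes such sets of size between \<open>n / k\<close> and \<open>n / 2\<close>, and then the
  vertices in smaller ones number fewer than \<open>n / k\<close> altogether (\<open>card_in_small_closed\<close>). So only a
  fraction of order \<open>1 / k\<close> of the pendant paths is expected to be attached at such a \<open>w\<close>, for
  every fixed \<open>k\<close>. With high probability some pendant path is therefore attached at a \<open>w\<close> whose
  component has more than \<open>n / 2\<close> vertices. This component is the largest one, and it contains the
  pendant path.
\<close>

section \<open>Eigenvalues from Rayleigh quotients\<close>

text \<open>
  Vectors of length \<open>N\<close> are functions on \<open>nat\<close> that vanish from \<open>N\<close> on, because the number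
  of vertices of a component is not fixed in advance. Their unit sphere is a closed subset of a
  product of compact intervals, hence compact by Tychonoff.
\<close>

lemma compact_finite_sphere:
  "compact {x :: nat \<Rightarrow> real. (\<forall>i\<ge>N. x i = 0) \<and> (\<Sum>i<N. (x i)\<^sup>2) = 1}" (is "compact ?S")
proof -
  define box where "box = PiE UNIV (\<lambda>i. if i < N then {-1..1::real} else {0})"
  have "compactin (product_topology (\<lambda>i::nat. euclidean :: real topology) UNIV) box"
    unfolding box_def compactin_PiE by auto
  hence "compact box"
    by (simp add: euclidean_product_topology)
  moreover have "closed {x :: nat \<Rightarrow> real. (\<Sum>i<N. (x i)\<^sup>2) = 1}"
    by (intro closed_Collect_eq continuous_on_sum continuous_on_power continuous_on_const
        continuous_on_product_coordinates)
  moreover have "?S = box \<inter> {x. (\<Sum>i<N. (x i)\<^sup>2) = 1}"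
  proof -
    have "\<bar>x i\<bar> \<le> 1" if "(\<Sum>i<N. (x i)\<^sup>2) = 1" "i < N" for x :: "nat \<Rightarrow> real" and i
    proof -
      have "(x i)\<^sup>2 \<le> (\<Sum>i<N. (x i)\<^sup>2)"
        using that(2) by (intro member_le_sum) auto
      thus ?thesis using that(1) by (simp add: abs_square_le_1)
    qed
    thus ?thesis
      unfolding box_def by (auto simp: PiE_iff abs_le_iff split: if_splits)
  qed
  ultimately show ?thesis by (simp add: compact_Int_closed)
qed

text \<open>
  The first-order condition at a maximum, for a quadratic polynomial in \<open>t\<close>.
\<close>

lemma eq_0_if_linear_le_quadratic:
  fixes b c :: real
  assumes "\<And>t. t * b \<le> t\<^sup>2 * c"
  shows "b = 0"
proof (rule ccontr)
  assume "b \<noteq> 0"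
  define K where "K = \<bar>c\<bar> + 1"
  have K: "K > 0" "c < K" unfolding K_def by auto
  have "b / K * b \<le> (b / K)\<^sup>2 * c" by (rule assms)
  hence "b\<^sup>2 * K \<le> b\<^sup>2 * c" using K by (simp add: field_simps power2_eq_square)
  thus False using \<open>b \<noteq> 0\<close> K by simp
qed

text \<open>
  The quadratic form attains its maximum \<open>\<mu>\<close> on the unit sphere. By homogeneity
  \<open>\<mu> |y|\<^sup>2 - B y y\<close> is nonnegative everywhere, and it vanishes at the maximiser \<open>x\<close>; varying \<open>x\<close> in
  each coordinate direction shows that \<open>x\<close> is an eigenvector.
\<close>

lemma rayleigh_maximiser:
  fixes a :: "nat \<Rightarrow> nat \<Rightarrow> real"
  assumes N: "N > 0" and sym: "\<And>i j. i < N \<Longrightarrow> j < N \<Longrightarrow> a i j = a j i"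
  obtains \<mu> x where "(\<Sum>i<N. (x i)\<^sup>2) = 1" "\<And>i. i < N \<Longrightarrow> (\<Sum>j<N. a i j * x j) = \<mu> * x i"
    "\<And>y. (\<Sum>i<N. \<Sum>j<N. a i j * y i * y j) \<le> \<mu> * (\<Sum>i<N. (y i)\<^sup>2)"
proof -
  define B where "B = (\<lambda>y z. \<Sum>i<N. \<Sum>j<N. a i j * y i * z j)"
  define S where "S = {x :: nat \<Rightarrow> real. (\<forall>i\<ge>N. x i = 0) \<and> (\<Sum>i<N. (x i)\<^sup>2) = 1}"
  have "(\<lambda>i. if i = 0 then 1 else 0) \<in> S"
    using N by (auto simp: S_def if_distrib[of "\<lambda>x. x\<^sup>2"] sum.delta cong: if_cong)
  moreover have "continuous_on S (\<lambda>x. B x x)"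
    unfolding B_def
    by (intro continuous_on_sum continuous_on_mult continuous_on_const)
       (rule continuous_on_subset[OF continuous_on_product_coordinates subset_UNIV])+
  ultimately obtain x where x: "x \<in> S" and max: "\<And>y. y \<in> S \<Longrightarrow> B y y \<le> B x x"
    using continuous_attains_sup[of S "\<lambda>x. B x x"] compact_finite_sphere[of N]
    unfolding S_def[symmetric] by blast
  define \<mu> where "\<mu> = B x x"
  have upper: "B y y \<le> \<mu> * (\<Sum>i<N. (y i)\<^sup>2)" for y
  proof (cases "(\<Sum>i<N. (y i)\<^sup>2) = 0")
    case True
    hence "\<forall>i<N. y i = 0" by (subst (asm) sum_nonneg_eq_0_iff) auto
    thus ?thesis by (simp add: B_def)
  next
    case False
    define s where "s = sqrt (\<Sum>i<N. (y i)\<^sup>2)"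
    have s: "s > 0" "s\<^sup>2 = (\<Sum>i<N. (y i)\<^sup>2)"
      using False by (auto simp: s_def sum_nonneg less_le)
    define z where "z = (\<lambda>i. if i < N then y i / s else 0)"
    have "(\<Sum>i<N. (z i)\<^sup>2) = (\<Sum>i<N. (y i)\<^sup>2) / s\<^sup>2"
      unfolding z_def sum_divide_distrib by (intro sum.cong) (auto simp: power_divide)
    hence "z \<in> S" using s by (auto simp: S_def z_def)
    hence "B z z \<le> \<mu>" unfolding \<mu>_def by (rule max)
    moreover have "B z z = B y y / s\<^sup>2"
      unfolding B_def z_def sum_divide_distrib
      by (intro sum.cong) (auto simp: power2_eq_square)
    ultimately have "B y y \<le> \<mu> * s\<^sup>2" using s(1) by (simp add: divide_le_eq)
    thus ?thesis by (simp only: s(2))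
  qed
  have xsq: "(\<Sum>i<N. (x i)\<^sup>2) = 1" using x by (simp add: S_def)
  (* The nonnegative form vanishes at x, so its derivative in the direction of e_k is 0 there. *)
  have eig: "(\<Sum>j<N. a k j * x j) = \<mu> * x k" if k: "k < N" for k
  proof -
    define e where "e = (\<lambda>i. if i = k then 1 else 0 :: real)"
    have Bxe: "B x e = (\<Sum>j<N. a k j * x j)"
      using k unfolding B_def e_def
      by (auto simp: if_distrib[of "\<lambda>t. _ * t"] sum.delta sym cong: if_cong intro!: sum.cong)
    have Bex: "B e x = (\<Sum>j<N. a k j * x j)"
    proof -
      have "B e x = (\<Sum>i<N. if i = k then (\<Sum>j<N. a k j * x j) else 0)"
        unfolding B_def e_def by (intro sum.cong) auto
      thus ?thesis using k by simp
    qed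
    have "t * (2 * ((\<Sum>j<N. a k j * x j) - \<mu> * x k)) \<le> t\<^sup>2 * (\<mu> - B e e)" for t
    proof -
      have "B (\<lambda>i. x i + t * e i) (\<lambda>i. x i + t * e i) = B x x + t * B x e + t * B e x + t\<^sup>2 * B e e"
        unfolding B_def
        by (simp add: algebra_simps sum.distrib sum_distrib_left power2_eq_square)
      moreover have "(\<Sum>i<N. (x i + t * e i)\<^sup>2) = 1 + 2 * t * x k + t\<^sup>2"
      proof -
        have "(\<Sum>i<N. (x i + t * e i)\<^sup>2) = (\<Sum>i<N. (x i)\<^sup>2 + (if i = k then 2 * t * x k + t\<^sup>2 else 0))"
          by (intro sum.cong) (auto simp: e_def power2_eq_square algebra_simps)
        thus ?thesis using k xsq by (simp add: sum.distrib)
      qed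
      ultimately show ?thesis
        using upper[of "\<lambda>i. x i + t * e i"] Bxe Bex by (simp add: \<mu>_def algebra_simps)
    qed
    from eq_0_if_linear_le_quadratic[OF this] show ?thesis by simp
  qed
  show ?thesis using that xsq eig upper unfolding B_def by blast
qed

text \<open>
  The maximum of the Rayleigh quotient is an eigenvalue, so every value \<open>c\<close> of the quotient is a
  lower bound for some eigenvalue.
\<close>

lemma symmetric_mat_eigenvalue_ge:
  fixes A :: "real mat"
  assumes A: "A \<in> carrier_mat N N" and sym: "A\<^sup>T = A"
    and pos: "(\<Sum>i<N. (y i)\<^sup>2) > 0"
    and ge: "(\<Sum>i<N. \<Sum>j<N. A $$ (i, j) * y i * y j) \<ge> c * (\<Sum>i<N. (y i)\<^sup>2)"
  obtains \<mu> where "eigenvalue A \<mu>" "\<mu> \<ge> c"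
proof -
  have N: "N > 0" using pos by (cases N) auto
  have entry_sym: "A $$ (i, j) = A $$ (j, i)" if "i < N" "j < N" for i j
    using A sym that by (metis carrier_matD index_transpose_mat(1))
  obtain \<mu> x where x: "(\<Sum>i<N. (x i)\<^sup>2) = 1"
    and ev: "\<And>i. i < N \<Longrightarrow> (\<Sum>j<N. A $$ (i, j) * x j) = \<mu> * x i"
    and up: "\<And>y. (\<Sum>i<N. \<Sum>j<N. A $$ (i, j) * y i * y j) \<le> \<mu> * (\<Sum>i<N. (y i)\<^sup>2)"
    by (rule rayleigh_maximiser[OF N, of "\<lambda>i j. A $$ (i, j)"]) (erule entry_sym, assumption, rule that)
  have "eigenvector A (vec N x) \<mu>"
  proof -
    have "vec N x \<noteq> 0\<^sub>v N"
    proof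
      assume "vec N x = 0\<^sub>v N"
      hence "\<forall>i<N. x i = 0" by (metis index_vec index_zero_vec(1))
      thus False using x by simp
    qed
    moreover have "A *\<^sub>v vec N x = \<mu> \<cdot>\<^sub>v vec N x"
    proof (rule eq_vecI)
      fix i assume "i < dim_vec (\<mu> \<cdot>\<^sub>v vec N x)"
      hence i: "i < N" by simp
      have "(A *\<^sub>v vec N x) $ i = (\<Sum>j<N. A $$ (i, j) * x j)"
        using A i by (simp add: scalar_prod_def row_def lessThan_atLeast0)
      thus "(A *\<^sub>v vec N x) $ i = (\<mu> \<cdot>\<^sub>v vec N x) $ i"
        using ev i by simp
    qed (use A in simp)
    ultimately show ?thesis using A by (simp add: eigenvector_def)
  qed
  moreover have "c \<le> \<mu>"
    using order.trans[OF ge up[of y]] pos by simp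
  ultimately show ?thesis using that unfolding eigenvalue_def by blast
qed

lemma symmetric_mat_eigenvalue_le:
  fixes A :: "real mat"
  assumes A: "A \<in> carrier_mat N N" and sym: "A\<^sup>T = A"
    and pos: "(\<Sum>i<N. (y i)\<^sup>2) > 0"
    and le: "(\<Sum>i<N. \<Sum>j<N. A $$ (i, j) * y i * y j) \<le> c * (\<Sum>i<N. (y i)\<^sup>2)"
  obtains \<mu> where "eigenvalue A \<mu>" "\<mu> \<le> c"
proof -
  have "(\<Sum>i<N. \<Sum>j<N. (- A) $$ (i, j) * y i * y j) = - (\<Sum>i<N. \<Sum>j<N. A $$ (i, j) * y i * y j)"
    using A by (simp flip: sum_negf)
  with le have ge: "- c * (\<Sum>i<N. (y i)\<^sup>2) \<le> (\<Sum>i<N. \<Sum>j<N. (- A) $$ (i, j) * y i * y j)"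
    by simp
  have "(- A)\<^sup>T = - A"
    using sym by (metis transpose_uminus)
  then obtain \<mu> where \<mu>: "eigenvalue (- A) \<mu>" "\<mu> \<ge> - c"
    using symmetric_mat_eigenvalue_ge[OF _ _ pos ge] A by (metis uminus_carrier_iff_mat)
  obtain v where v: "eigenvector (- A) v \<mu>" using \<mu>(1) by (auto simp: eigenvalue_def)
  hence vc: "v \<in> carrier_vec N" using A by (auto simp: eigenvector_def)
  have "A *\<^sub>v v = - ((- A) *\<^sub>v v)"
    using A vc by (intro eq_vecI) (auto simp: scalar_prod_def sum_negf)
  also have "\<dots> = (- \<mu>) \<cdot>\<^sub>v v" using v vc by (auto simp: eigenvector_def)
  finally have "eigenvector A v (- \<mu>)" using v A by (auto simp: eigenvector_def)
  thus ?thesis using that[of "- \<mu>"] \<mu>(2) unfolding eigenvalue_def by auto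
qed

section \<open>A pendant path forces a large Laplacian eigenvalue\<close>

lemma normalized_laplacian_carrier:
  "normalized_laplacian G \<in> carrier_mat (card (verts G)) (card (verts G))"
  unfolding normalized_laplacian_def positive_degree_projection_def inv_sqrt_degree_matrix_def
  by (intro minus_carrier_mat mult_carrier_mat[where n = "card (verts G)"]) (simp_all add: mat_diag_def adjacency_matrix_def)

lemma normalized_laplacian_entry:
  fixes G :: "('a :: linorder, 'b) pre_digraph"
  assumes ij: "i < card (verts G)" "j < card (verts G)"
  shows "normalized_laplacian G $$ (i, j) =
    (if i = j \<and> out_degree G (vertex G i) > 0 then 1 else 0)
    - (if out_degree G (vertex G i) \<noteq> 0 \<and> out_degree G (vertex G j) \<noteq> 0
          \<and> vertex G i \<rightarrow>\<^bsub>G\<^esub> vertex G j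
       then 1 / (sqrt (out_degree G (vertex G i)) * sqrt (out_degree G (vertex G j))) else 0)"
proof -
  let ?N = "card (verts G)"
  define f where "f = (\<lambda>i. if out_degree G (vertex G i) = 0 then 0
            else 1 / sqrt (real (out_degree G (vertex G i))))"
  have A: "adjacency_matrix G \<in> carrier_mat ?N ?N" by (simp add: adjacency_matrix_def)
  have "inv_sqrt_degree_matrix G * adjacency_matrix G * inv_sqrt_degree_matrix G
      = Matrix.mat ?N ?N (\<lambda>(i, j). f i * adjacency_matrix G $$ (i, j) * f j)"
    unfolding inv_sqrt_degree_matrix_def f_def[symmetric] mat_diag_mult_left[OF A]
    by (subst mat_diag_mult_right[of _ ?N]) auto
  thus ?thesis
    using ij by (simp add: normalized_laplacian_def positive_degree_projection_def mat_diag_def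
        adjacency_matrix_def f_def)
qed

lemma obtain_vertex_index:
  assumes "finite (verts G)" "v \<in> verts G"
  obtains i where "i < card (verts G)" "vertex G i = v"
  using assms unfolding vertex_def by (metis in_set_conv_nth set_sorted_list_of_set length_sorted_list_of_set)

text \<open>
  The form and the norm at the vector \<open>e\<^sub>a + t e\<^sub>b\<close>; the Laplacian is tested with \<open>t = 1\<close> and
  \<open>t = - 1\<close>.
\<close>

lemma quadratic_form_two_points:
  fixes L :: "nat \<Rightarrow> nat \<Rightarrow> real"
  assumes "a < N" "b < N" "a \<noteq> b" and y: "y = (\<lambda>i. if i = a then 1 else if i = b then t else 0)"
  shows "(\<Sum>i<N. \<Sum>j<N. L i j * y i * y j) = L a a + t * L a b + t * L b a + t\<^sup>2 * L b b"
    and "(\<Sum>i<N. (y i)\<^sup>2) = 1 + t\<^sup>2"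
proof -
  have *: "(\<Sum>i<N. f i) = f a + f b" if "\<And>i. i \<noteq> a \<Longrightarrow> i \<noteq> b \<Longrightarrow> f i = 0" for f :: "nat \<Rightarrow> real"
  proof -
    have "(\<Sum>i<N. f i) = (\<Sum>i\<in>{a, b}. f i)"
      using assms that by (intro sum.mono_neutral_right) auto
    thus ?thesis using assms by simp
  qed
  show "(\<Sum>i<N. (y i)\<^sup>2) = 1 + t\<^sup>2"
    by (subst *) (use assms in auto)
  have "(\<Sum>j<N. L i j * y i * y j) = L i a * y i + t * L i b * y i" for i
    by (subst *) (use assms in auto)
  thus "(\<Sum>i<N. \<Sum>j<N. L i j * y i * y j) = L a a + t * L a b + t * L b a + t\<^sup>2 * L b b"
    by (simp, subst *) (use assms in \<open>auto simp: power2_eq_square algebra_simps\<close>)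
qed

lemma eigenvalue_in_laplacian_eigenvalues:
  assumes "eigenvalue (normalized_laplacian G) \<mu>"
  shows "\<mu> \<in> set (laplacian_eigenvalues G)"
proof -
  let ?L = "normalized_laplacian G"
  have "char_poly ?L \<noteq> 0"
    using degree_monic_char_poly[OF normalized_laplacian_carrier, of G] by auto
  thus ?thesis
    using assms eigenvalue_root_char_poly[OF normalized_laplacian_carrier]
    by (auto simp: laplacian_eigenvalues_def)
qed

text \<open>
  The quantity \<open>\<lambda>\<close> leaves out the first entry of the sorted list of eigenvalues. An eigenvalue
  \<open>\<mu>\<close> that exceeds another one is not that entry.
\<close>

lemma spectral_lambda_ge_gap:
  assumes "\<mu> \<in> set (laplacian_eigenvalues G)" "\<nu> \<in> set (laplacian_eigenvalues G)" "\<nu> < \<mu>"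
  shows "spectral_lambda G \<ge> \<mu> - 1"
proof -
  let ?l = "laplacian_eigenvalues G"
  let ?M = "{\<bar>1 - ?l ! i\<bar> | i. 1 \<le> i \<and> i < length ?l}"
  obtain i j where i: "i < length ?l" "?l ! i = \<mu>" and j: "j < length ?l" "?l ! j = \<nu>"
    using assms(1,2) unfolding in_set_conv_nth by metis
  have "sorted ?l" by (simp add: laplacian_eigenvalues_def)
  hence "?l ! 0 \<le> \<nu>" using j by (auto intro: sorted_nth_mono)
  hence "i \<noteq> 0" using i \<open>\<nu> < \<mu>\<close> by (metis not_le)
  hence "\<bar>1 - \<mu>\<bar> \<in> ?M" using i(1) unfolding i(2)[symmetric]
    by (intro CollectI exI[of _ i]) auto
  moreover have "finite ?M"
    by (rule finite_subset[of _ "(\<lambda>i. \<bar>1 - ?l ! i\<bar>) ` {..<length ?l}"]) auto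
  ultimately have "\<bar>1 - \<mu>\<bar> \<le> spectral_lambda G"
    unfolding spectral_lambda_def by (intro Max_ge)
  thus ?thesis by linarith
qed

text \<open>
  On the span of \<open>e\<^sub>v\<close> and \<open>e\<^sub>u\<close> the Laplacian has diagonal entries 1 and off-diagonal entry
  \<open>- 1 / sqrt (1 * 2)\<close>, which gives Rayleigh quotients \<open>1 + 1 / sqrt 2\<close> and \<open>1 - 1 / sqrt 2\<close>.
\<close>

lemma spectral_lambda_ge_half_if_pendant:
  fixes H :: "('a :: linorder, 'b) pre_digraph"
  assumes fin: "finite (verts H)" and vu: "v \<in> verts H" "u \<in> verts H" "v \<noteq> u"
    and sym: "\<And>a b. a \<rightarrow>\<^bsub>H\<^esub> b \<Longrightarrow> b \<rightarrow>\<^bsub>H\<^esub> a"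
    and noloop: "\<not> v \<rightarrow>\<^bsub>H\<^esub> v" "\<not> u \<rightarrow>\<^bsub>H\<^esub> u" and adj: "v \<rightarrow>\<^bsub>H\<^esub> u"
    and deg: "out_degree H v = 1" "out_degree H u = 2"
  shows "spectral_lambda H \<ge> 1 / 2"
proof -
  define N where "N = card (verts H)"
  define L where "L = normalized_laplacian H"
  have L: "L \<in> carrier_mat N N" unfolding L_def N_def by (rule normalized_laplacian_carrier)
  have L_sym: "L\<^sup>T = L"
  proof (rule eq_matI)
    fix i j assume "i < dim_row L" "j < dim_col L"
    moreover have "vertex H i \<rightarrow>\<^bsub>H\<^esub> vertex H j \<longleftrightarrow> vertex H j \<rightarrow>\<^bsub>H\<^esub> vertex H i"
      by (auto intro: sym)
    ultimately show "L\<^sup>T $$ (i, j) = L $$ (i, j)"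
      using L by (auto simp: L_def N_def normalized_laplacian_entry mult.commute)
  qed (use L in auto)
  obtain a b where a: "a < N" "vertex H a = v" and b: "b < N" "vertex H b = u"
    using obtain_vertex_index[OF fin] vu unfolding N_def by metis
  have ab: "a \<noteq> b" using a b vu by auto
  have entries: "L $$ (a, a) = 1" "L $$ (b, b) = 1" "L $$ (a, b) = - 1 / sqrt 2" "L $$ (b, a) = - 1 / sqrt 2"
    using a b ab noloop adj sym[OF adj] deg unfolding L_def N_def
    by (auto simp: normalized_laplacian_entry)
  have sqrt2: "1 / 2 \<le> 1 / sqrt 2" by (simp add: field_simps real_le_lsqrt)
  define y :: "real \<Rightarrow> nat \<Rightarrow> real" where "y = (\<lambda>t i. if i = a then 1 else if i = b then t else 0)"
  note Q = quadratic_form_two_points[OF a(1) b(1) ab, of "y t" t for t]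
  have norm: "(\<Sum>i<N. (y t i)\<^sup>2) = 1 + t\<^sup>2" for t
    by (rule Q(2)) (simp add: y_def)
  have form: "(\<Sum>i<N. \<Sum>j<N. L $$ (i, j) * y t i * y t j) = 1 + t\<^sup>2 - 2 * t / sqrt 2" for t
    by (subst Q(1)[of t "\<lambda>i j. L $$ (i, j)"]) (simp_all add: y_def entries)
  have pos: "(\<Sum>i<N. (y t i)\<^sup>2) > 0" for t
    unfolding norm by (smt (verit) zero_le_power2)
  have "(1 + 1 / sqrt 2) * (\<Sum>i<N. (y (- 1) i)\<^sup>2) \<le> (\<Sum>i<N. \<Sum>j<N. L $$ (i, j) * y (- 1) i * y (- 1) j)"
    unfolding form[of 1] norm[of 1] form[of "- 1"] norm[of "- 1"] by (simp add: algebra_simps)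
  from symmetric_mat_eigenvalue_ge[OF L L_sym pos this]
  obtain \<mu> where \<mu>: "eigenvalue L \<mu>" "1 + 1 / sqrt 2 \<le> \<mu>"
    by metis
  have "(\<Sum>i<N. \<Sum>j<N. L $$ (i, j) * y 1 i * y 1 j) \<le> (1 - 1 / sqrt 2) * (\<Sum>i<N. (y 1 i)\<^sup>2)"
    unfolding form[of 1] norm[of 1] form[of "- 1"] norm[of "- 1"] by (simp add: algebra_simps)
  from symmetric_mat_eigenvalue_le[OF L L_sym pos this]
  obtain \<nu> where \<nu>: "eigenvalue L \<nu>" "\<nu> \<le> 1 - 1 / sqrt 2"
    by metis
  have "\<nu> < \<mu>" using \<mu> \<nu> sqrt2 by linarith
  hence "spectral_lambda H \<ge> \<mu> - 1"
    using \<mu> \<nu> unfolding L_def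
    by (intro spectral_lambda_ge_gap[of \<mu> H \<nu>] eigenvalue_in_laplacian_eigenvalues)
  thus ?thesis using \<mu>(2) sqrt2 by linarith
qed

section \<open>Locating the largest component\<close>

lemma strongly_connected_imp_connected:
  assumes "strongly_connected G"
  shows "connected G"
proof -
  have "(u, v) \<in> rtrancl_on (verts G) ((arcs_ends G)\<^sup>s)" if "u \<rightarrow>\<^sup>*\<^bsub>G\<^esub> v" for u v
    using that unfolding reachable_def by (rule rtrancl_on_mono[rotated 2]) (auto simp: symcl_def)
  thus ?thesis
    using assms unfolding connected_conv strongly_connected_def by simp
qed

lemma arc_mono_connected: "arc_mono connected"
  unfolding arc_mono_def
proof (intro allI impI, elim conjE)
  fix H1 H2 :: "('a, 'b) pre_digraph"
  assume "connected H1" "subgraph H1 H2" "verts H1 = verts H2"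
  thus "connected H2"
    by (intro wf_digraph.connected_spanning_imp_connected[of H2 H1]) (auto simp: spanning_def)
qed

context sym_digraph
begin

text \<open>
  In a symmetric digraph weak and strong connectivity agree, so that the theory of strongly
  connected components applies to the components that occur in \<open>largest_component\<close>.
\<close>

lemma connected_component_in_sccs:
  assumes "max_subgraph connected H"
  shows "H \<in> sccs"
proof -
  from assms arc_mono_connected have ind: "induced_subgraph H G" by (rule induced_subgraphI_arc_mono)
  then interpret H: sym_digraph H by (rule induced_graph_imp_graph)
  have "strongly_connected H"
    using max_subgraph_prop[OF assms] by (rule H.symmetric_connected_imp_strongly_connected[OF H.sym_arcs])
  hence "max_subgraph strongly_connected H"
    by (intro max_subgraph_mp[OF assms] strongly_connected_imp_connected)
  thus ?thesis by (simp add: sccs_altdef2)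
qed

lemma connected_subgraph_reachable:
  assumes "subgraph H G" "connected H" "u \<in> verts H" "v \<in> verts H"
  shows "u \<rightarrow>\<^sup>* v"
proof -
  have "u \<rightarrow>\<^sup>*\<^bsub>mk_symmetric H\<^esub> v"
    using assms unfolding connected_def strongly_connected_def by simp
  hence "u \<rightarrow>\<^sup>*\<^bsub>mk_symmetric G\<^esub> v"
    using pre_digraph.reachable_mono subgraph_mk_symmetric[OF assms(1)] by fast
  thus ?thesis using sym_arcs by (simp only: reachable_mk_symmetric_eq)
qed

text \<open>
  A connected subgraph that contains \<open>w\<close> only has vertices reachable from \<open>w\<close>, and the induced
  subgraph on these already has all arcs.
\<close>

lemma reachable_set_is_component:
  assumes w: "w \<in> verts G"
  shows "max_subgraph connected (G \<restriction> {v. w \<rightarrow>\<^sup>* v})"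
proof (rule max_subgraphI)
  let ?C = "G \<restriction> {v. w \<rightarrow>\<^sup>* v}"
  have C: "?C \<in> sccs" using w by (rule induce_reachable_is_in_sccs)
  show "connected ?C" using C by (auto intro: strongly_connected_imp_connected)
  show "subgraph ?C G" using C by (auto dest: in_sccs_imp_induced)
  fix H assume H: "?C \<noteq> H" "subgraph ?C H" "subgraph H G"
  show "\<not> connected H"
  proof
    assume conn: "connected H"
    have sub: "{v. w \<rightarrow>\<^sup>* v} \<subseteq> verts H"
      using subgraph_imp_subverts[OF H(2)] by simp
    moreover have "w \<in> verts H" using sub w by auto
    ultimately have verts: "verts H = {v. w \<rightarrow>\<^sup>* v}"
      using connected_subgraph_reachable[OF H(3) conn] by auto
    have "subgraph H ?C"
      using subgraph_induce_subgraphI2[OF H(3)] unfolding verts .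
    hence "arcs H \<subseteq> arcs ?C" unfolding subgraph_def by (elim conjE)
    hence "arcs H = arcs ?C" using H(2) by blast
    moreover have "tail H = tail ?C" "head H = head ?C"
      using H(3) by (auto simp: subgraph_def compatible_def)
    ultimately show False using H(1) verts by (auto intro: pre_digraph.equality)
  qed
qed

lemma component_reachable_closed:
  assumes "max_subgraph connected H" "u \<in> verts H" "u \<rightarrow>\<^sup>* v"
  shows "v \<in> verts H"
proof -
  have "verts H \<in> sccs_verts"
    using connected_component_in_sccs[OF assms(1)] by (auto simp: sccs_verts_conv)
  moreover have "v \<rightarrow>\<^sup>* u" using assms(3) sym_arcs by (metis symmetric_reachable)
  ultimately show ?thesis using assms(2,3) unfolding sccs_verts_def by blast
qed

text \<open>
  The set reachable from \<open>w\<close> is closed, so it has more than half of all vertices, and the largest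
  component has at least as many. The two sets therefore meet, and then they coincide.
\<close>

lemma in_largest_component:
  assumes H: "largest_component G H" and fin: "finite (verts G)" and w: "w \<in> verts G"
    and large: "\<And>S. S \<subseteq> verts G \<Longrightarrow> w \<in> S \<Longrightarrow> (\<And>a b. a \<in> S \<Longrightarrow> a \<rightarrow> b \<Longrightarrow> b \<in> S)
      \<Longrightarrow> card (verts G) < 2 * card S"
  shows "w \<in> verts H"
proof -
  let ?S = "{v. w \<rightarrow>\<^sup>* v}"
  have max: "max_subgraph connected H" using H by (simp add: largest_component_def)
  have sub: "?S \<subseteq> verts G" "verts H \<subseteq> verts G"
    using subgraphI_max_subgraph[OF max] by (auto dest: reachable_in_verts)
  have "card (verts G) < 2 * card ?S"
    using w sub by (intro large) (auto intro: reachable_adj_trans)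
  moreover have "card ?S \<le> card (verts H)"
    using H reachable_set_is_component[OF w] unfolding largest_component_def by fastforce
  ultimately have "card (verts G) < card ?S + card (verts H)" by simp
  moreover have "card (?S \<union> verts H) \<le> card (verts G)"
    using sub fin by (intro card_mono) auto
  ultimately have "?S \<inter> verts H \<noteq> {}"
    using sub fin card_Un_disjoint[of ?S "verts H"] by (metis finite_subset not_le)
  then obtain x where "w \<rightarrow>\<^sup>* x" "x \<in> verts H" by auto
  thus ?thesis
    using component_reachable_closed[OF max] sym_arcs by (metis symmetric_reachable)
qed

end

definition pendant :: "nat set set \<Rightarrow> nat \<Rightarrow> nat \<Rightarrow> nat \<Rightarrow> bool" where
  "pendant E v u w \<longleftrightarrow> distinct [v, u, w] \<and>
     (\<forall>x. {v, x} \<in> E \<longleftrightarrow> x = u) \<and> (\<forall>x. {u, x} \<in> E \<longleftrightarrow> x = v \<or> x = w)"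

text \<open>
  The set \<open>S\<close> is a union of components of the subgraph that \<open>E\<close> induces on \<open>U\<close>. Working with such
  unions instead of single components makes the condition a statement about absent edges only.
\<close>

definition closed_in :: "nat set set \<Rightarrow> nat set \<Rightarrow> nat set \<Rightarrow> bool" where
  "closed_in E U S \<longleftrightarrow> S \<subseteq> U \<and> (\<forall>a\<in>S. \<forall>b\<in>U - S. {a, b} \<notin> E)"

text \<open>
  With \<open>U\<close> the set of all \<open>k\<close> vertices, the negation says that the component of \<open>w\<close>
  has more than half of the vertices.
\<close>

definition in_small_closed :: "nat set set \<Rightarrow> nat set \<Rightarrow> nat \<Rightarrow> nat \<Rightarrow> bool" where
  "in_small_closed E U k w \<longleftrightarrow> (\<exists>S. closed_in E U S \<and> w \<in> S \<and> 2 * card S \<le> k)"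

lemma pair_graph_graph_of_edges:
  assumes "E \<subseteq> possible_edges n"
  shows "pair_graph (graph_of_edges n E)"
proof -
  have sub: "parcs (graph_of_edges n E) \<subseteq> {..<n} \<times> {..<n}"
    using assms by (auto simp: graph_of_edges_def possible_edges_def)
  have "finite (parcs (graph_of_edges n E))" by (rule finite_subset[OF sub]) auto
  thus ?thesis using sub
    by unfold_locales (auto simp: graph_of_edges_def symmetric_def sym_def insert_commute)
qed

text \<open>
  The vertex \<open>w\<close> lies in the largest component, which is closed under taking neighbours
  and so contains \<open>u\<close> and \<open>v\<close> with all edges at them. The degrees of \<open>u\<close> and \<open>v\<close> within the
  component are thus their degrees in the whole graph.
\<close>

lemma spectral_lambda_largest_component:
  assumes E: "E \<subseteq> possible_edges n" and pend: "pendant E v u w"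
    and large: "\<not> in_small_closed E {..<n} n w"
    and H: "largest_component (with_proj (graph_of_edges n E)) H"
  shows "spectral_lambda H \<ge> 1 / 2"
proof -
  let ?G = "with_proj (graph_of_edges n E)"
  interpret PG: pair_graph "graph_of_edges n E" by (rule pair_graph_graph_of_edges[OF E])
  have sym: "sym_digraph ?G" by unfold_locales
  have vG: "verts ?G = {..<n}" by (simp add: graph_of_edges_def)
  have adj: "a \<rightarrow>\<^bsub>?G\<^esub> b \<longleftrightarrow> a \<noteq> b \<and> {a, b} \<in> E" for a b
    by (simp add: graph_of_edges_def)
  have distinct: "v \<noteq> u" "v \<noteq> w" "u \<noteq> w"
    and nbrs: "\<And>x. {v, x} \<in> E \<longleftrightarrow> x = u" "\<And>x. {u, x} \<in> E \<longleftrightarrow> x = v \<or> x = w"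
    using pend by (auto simp: pendant_def)
  have lt: "v < n" "u < n" "w < n"
    using nbrs E by (auto simp: possible_edges_def)
  have max: "pre_digraph.max_subgraph ?G connected H" using H by (simp add: largest_component_def)
  have "w \<in> verts H"
  proof (rule sym_digraph.in_largest_component[OF sym H])
    show "finite (verts ?G)" "w \<in> verts ?G" using lt vG by auto
  next
    fix S assume S: "S \<subseteq> verts ?G" "w \<in> S" "\<And>a b. a \<in> S \<Longrightarrow> a \<rightarrow>\<^bsub>?G\<^esub> b \<Longrightarrow> b \<in> S"
    have "closed_in E {..<n} S"
      unfolding closed_in_def
    proof (intro conjI ballI notI)
      fix a b assume ab: "a \<in> S" "b \<in> {..<n} - S" "{a, b} \<in> E"
      hence "a \<rightarrow>\<^bsub>?G\<^esub> b" unfolding adj by auto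
      thus False using S(3) ab by blast
    qed (use S(1) vG in simp)
    thus "card (verts ?G) < 2 * card S"
      using large S(2) unfolding in_small_closed_def vG by auto
  qed
  moreover have "w \<rightarrow>\<^bsub>?G\<^esub> u" "u \<rightarrow>\<^bsub>?G\<^esub> v"
    using nbrs(2)[of w] nbrs(2)[of v] distinct unfolding adj by (auto simp: insert_commute)
  moreover note closed = sym_digraph.component_reachable_closed[OF sym max _ PG.reachable_adjI]
  ultimately have inH: "w \<in> verts H" "u \<in> verts H" "v \<in> verts H"
    using closed[of w u] closed[of u v] by simp_all
  have ind: "induced_subgraph H ?G"
    using sym_digraph.connected_component_in_sccs[OF sym max] by (rule pre_digraph.in_sccs_imp_induced)
  hence th: "tail H = fst" "head H = snd"
    unfolding induced_subgraph_def subgraph_def compatible_def by auto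
  have arcs: "arcs H = {e \<in> parcs (graph_of_edges n E). fst e \<in> verts H \<and> snd e \<in> verts H}"
    using ind unfolding induced_subgraph_def by simp
  have adjH: "a \<rightarrow>\<^bsub>H\<^esub> b \<longleftrightarrow> a \<in> verts H \<and> b \<in> verts H \<and> a \<noteq> b \<and> {a, b} \<in> E" for a b
  proof -
    have "arcs_ends H = arcs H" by (simp add: arcs_ends_def arc_to_ends_def th)
    thus ?thesis unfolding arcs graph_of_edges_def by auto
  qed
  have deg: "out_degree H a = card {b \<in> verts H. a \<noteq> b \<and> {a, b} \<in> E}" if "a \<in> verts H" for a
  proof -
    have "out_arcs H a = Pair a ` {b \<in> verts H. a \<noteq> b \<and> {a, b} \<in> E}"
      using that unfolding out_arcs_def arcs th graph_of_edges_def by auto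
    thus ?thesis by (simp add: out_degree_def card_image inj_on_def)
  qed
  show ?thesis
  proof (rule spectral_lambda_ge_half_if_pendant[of H v u])
    show "finite (verts H)"
      using subgraph_imp_subverts[OF induced_imp_subgraph[OF ind]] unfolding vG
      by (rule finite_subset) simp
    show "b \<rightarrow>\<^bsub>H\<^esub> a" if "a \<rightarrow>\<^bsub>H\<^esub> b" for a b
      using that unfolding adjH by (auto simp: insert_commute)
    have "{b \<in> verts H. v \<noteq> b \<and> {v, b} \<in> E} = {u}" using nbrs(1) distinct inH by auto
    thus "out_degree H v = 1" using deg inH by simp
    have "{b \<in> verts H. u \<noteq> b \<and> {u, b} \<in> E} = {v, w}" using nbrs(2) distinct inH by auto
    thus "out_degree H u = 2" using deg inH distinct by simp
  qed (use inH distinct nbrs in \<open>auto simp: adjH\<close>)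
qed

text \<open>
  Take a closed set \<open>T\<close> of maximal size among those with at most \<open>n / 2\<close> vertices. The union of
  \<open>T\<close> with another such set \<open>S\<close> is closed and has fewer than \<open>2 m \<le> n / 2\<close> vertices, so by
  maximality it is \<open>T\<close>. Thus all these sets lie in \<open>T\<close>, which has fewer than \<open>m\<close> vertices.
\<close>

lemma card_in_small_closed:
  assumes fin: "finite U" and cut: "\<And>S. closed_in E U S \<Longrightarrow> 2 * card S \<le> n \<Longrightarrow> card S < m" and m: "4 * m \<le> n"
  shows "card {w \<in> U. in_small_closed E U n w} \<le> m"
proof -
  define A where "A = {S. closed_in E U S \<and> 2 * card S \<le> n}"
  have "A \<subseteq> Pow U" by (auto simp: A_def closed_in_def)
  hence finA: "finite A" using fin by (auto intro: finite_subset)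
  have "{} \<in> A" by (auto simp: A_def closed_in_def)
  with finA obtain T where T: "T \<in> A" and T_max: "Max (card ` A) = card T"
    by (metis obtains_MAX empty_iff)
  have maxT: "card S \<le> card T" if "S \<in> A" for S
    unfolding T_max[symmetric] using finA that by simp
  have finS: "finite S" if "S \<in> A" for S
    using that fin by (auto simp: A_def closed_in_def intro: finite_subset)
  have small: "card S < m" if "S \<in> A" for S using that cut by (auto simp: A_def)
  have "S \<subseteq> T" if S: "S \<in> A" for S
  proof -
    have "card (S \<union> T) \<le> card S + card T" by (rule card_Un_le)
    hence "2 * card (S \<union> T) \<le> n" using small[OF S] small[OF T] m by linarith
    hence "S \<union> T \<in> A" using S T by (auto simp: A_def closed_in_def)
    hence "card (S \<union> T) \<le> card T" by (rule maxT)
    hence "S \<union> T = T" using finS S T by (intro card_seteq[symmetric]) auto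
    thus ?thesis by blast
  qed
  hence "{w \<in> U. in_small_closed E U n w} \<subseteq> T" unfolding in_small_closed_def A_def by blast
  hence "card {w \<in> U. in_small_closed E U n w} \<le> card T" using finS[OF T] by (rule card_mono[rotated])
  thus ?thesis using small[OF T] by linarith
qed

section \<open>Random subsets and the second moment method\<close>

text \<open>
  For the set of possible edges of a graph this is the edge set of \<open>G(n, p)\<close>.
\<close>

definition random_subset :: "'a set \<Rightarrow> real \<Rightarrow> 'a set pmf" where
  "random_subset A p = map_pmf (\<lambda>f. {x \<in> A. f x}) (Pi_pmf A False (\<lambda>_. bernoulli_pmf p))"

lemma set_random_subset: "set_pmf (random_subset A p) \<subseteq> Pow A"
  by (auto simp: random_subset_def)

lemma finite_set_random_subset:
  assumes "finite A"
  shows "finite (set_pmf (random_subset A p))"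
  using assms by (intro finite_subset[OF set_random_subset]) simp

lemma random_subset_Un:
  assumes "finite A" "finite B" "A \<inter> B = {}"
  shows "random_subset (A \<union> B) p
    = map_pmf (\<lambda>(X, Y). X \<union> Y) (pair_pmf (random_subset A p) (random_subset B p))"
  unfolding random_subset_def Pi_pmf_union[OF assms] map_pair[symmetric] pmf.map_comp o_def
  using assms by (intro map_pmf_cong) auto

text \<open>
  Events that constrain the traces of a random set on disjoint sets \<open>A\<close> and \<open>B\<close> separately are
  independent.
\<close>

lemma prob_random_subset_Un:
  assumes AB: "finite A" "finite B" "A \<inter> B = {}"
    and F: "\<And>X Y. X \<subseteq> A \<Longrightarrow> Y \<subseteq> B \<Longrightarrow> X \<union> Y \<in> F \<longleftrightarrow> X \<in> FA \<and> Y \<in> FB"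
  shows "measure_pmf.prob (random_subset (A \<union> B) p) F
    = measure_pmf.prob (random_subset A p) FA * measure_pmf.prob (random_subset B p) FB"
proof -
  let ?P = "pair_pmf (random_subset A p) (random_subset B p)"
  let ?FA = "FA \<inter> set_pmf (random_subset A p)" and ?FB = "FB \<inter> set_pmf (random_subset B p)"
  have "measure_pmf.prob (random_subset (A \<union> B) p) F
      = measure_pmf.prob ?P ((\<lambda>(X, Y). X \<union> Y) -` F \<inter> set_pmf ?P)"
    unfolding random_subset_Un[OF AB] measure_map_pmf measure_Int_set_pmf ..
  also have "(\<lambda>(X, Y). X \<union> Y) -` F \<inter> set_pmf ?P = ?FA \<times> ?FB"
  proof -
    have "(X, Y) \<in> (\<lambda>(X, Y). X \<union> Y) -` F \<inter> set_pmf ?P \<longleftrightarrow> (X, Y) \<in> ?FA \<times> ?FB" for X Y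
    proof (cases "X \<in> set_pmf (random_subset A p) \<and> Y \<in> set_pmf (random_subset B p)")
      case True
      hence "X \<subseteq> A" "Y \<subseteq> B" using set_random_subset by blast+
      from F[OF this] True show ?thesis by simp
    qed auto
    thus ?thesis unfolding set_eq_iff split_paired_All by blast
  qed
  also have "measure_pmf.prob ?P (?FA \<times> ?FB)
      = measure_pmf.prob (random_subset A p) ?FA * measure_pmf.prob (random_subset B p) ?FB"
    using finite_set_random_subset AB by (intro measure_pmf_prob_product countable_finite) auto
  finally show ?thesis unfolding measure_Int_set_pmf .
qed

lemma prob_random_subset_prescribed:
  assumes "finite I" "finite J" "I \<inter> J = {}" and p: "0 \<le> p" "p \<le> 1"
  shows "measure_pmf.prob (random_subset (I \<union> J) p) {X. I \<subseteq> X \<and> X \<inter> J = {}} = p ^ card I * (1 - p) ^ card J"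
proof -
  let ?S = "\<lambda>x. if x \<in> I then {True} else {False}"
  have "(\<lambda>f. {x \<in> I \<union> J. f x}) -` {X. I \<subseteq> X \<and> X \<inter> J = {}} = Pi (I \<union> J) ?S"
    using assms(3) by (auto simp: Pi_def)
  hence "measure_pmf.prob (random_subset (I \<union> J) p) {X. I \<subseteq> X \<and> X \<inter> J = {}}
      = (\<Prod>x\<in>I \<union> J. measure_pmf.prob (bernoulli_pmf p) (?S x))"
    unfolding random_subset_def measure_map_pmf using assms(1,2) by (simp only: measure_Pi_pmf_Pi finite_Un)
  also have "\<dots> = (\<Prod>x\<in>I. measure_pmf.prob (bernoulli_pmf p) (?S x)) * (\<Prod>x\<in>J. measure_pmf.prob (bernoulli_pmf p) (?S x))"
    using assms by (intro prod.union_disjoint) auto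
  also have "(\<Prod>x\<in>I. measure_pmf.prob (bernoulli_pmf p) (?S x)) = p ^ card I"
    using p by (simp add: measure_pmf_single)
  also have "(\<Prod>x\<in>J. measure_pmf.prob (bernoulli_pmf p) (?S x)) = (\<Prod>x\<in>J. 1 - p)"
    using assms(3) p by (intro prod.cong) (auto simp: measure_pmf_single)
  finally show ?thesis by simp
qed

text \<open>
  Prescribing the elements of \<open>I\<close> and excluding those of \<open>J\<close> is independent of every property \<open>Q\<close>
  that only depends on the trace on a set \<open>D\<close> disjoint from \<open>I\<close> and \<open>J\<close>.
\<close>

lemma prob_random_subset_indep:
  assumes A: "finite A" and IJ: "I \<subseteq> A" "J \<subseteq> A" "I \<inter> J = {}" and p: "0 \<le> p" "p \<le> 1"
    and D: "D \<inter> (I \<union> J) = {}" and Q: "\<And>X Y. X \<inter> D = Y \<inter> D \<Longrightarrow> Q X \<longleftrightarrow> Q Y"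
  shows "measure_pmf.prob (random_subset A p) {X. I \<subseteq> X \<and> X \<inter> J = {} \<and> Q X}
    = p ^ card I * (1 - p) ^ card J * measure_pmf.prob (random_subset A p) {X. Q X}"
proof -
  let ?C = "I \<union> J"
  have split: "A = ?C \<union> (A - ?C)" using IJ by blast
  have fin: "finite I" "finite J" using A IJ by (auto intro: finite_subset)
  have QY: "Q (X \<union> Y) \<longleftrightarrow> Q Y" if "X \<subseteq> ?C" for X Y
    using that D by (intro Q) auto
  have "measure_pmf.prob (random_subset (?C \<union> (A - ?C)) p) {X. Q X}
      = measure_pmf.prob (random_subset ?C p) UNIV * measure_pmf.prob (random_subset (A - ?C) p) {X. Q X}"
    by (rule prob_random_subset_Un) (use A fin QY in auto)
  hence Q_eq: "measure_pmf.prob (random_subset A p) {X. Q X}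
      = measure_pmf.prob (random_subset (A - ?C) p) {X. Q X}"
    unfolding split[symmetric] by (simp add: measure_pmf.prob_space[simplified])
  have "measure_pmf.prob (random_subset (?C \<union> (A - ?C)) p) {X. I \<subseteq> X \<and> X \<inter> J = {} \<and> Q X}
      = measure_pmf.prob (random_subset ?C p) {X. I \<subseteq> X \<and> X \<inter> J = {}}
        * measure_pmf.prob (random_subset (A - ?C) p) {X. Q X}"
  proof (rule prob_random_subset_Un)
    fix X Y assume "X \<subseteq> ?C" "Y \<subseteq> A - ?C"
    moreover from this have "I \<subseteq> X \<union> Y \<longleftrightarrow> I \<subseteq> X" "(X \<union> Y) \<inter> J = {} \<longleftrightarrow> X \<inter> J = {}" by auto
    ultimately show "X \<union> Y \<in> {X. I \<subseteq> X \<and> X \<inter> J = {} \<and> Q X}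
        \<longleftrightarrow> X \<in> {X. I \<subseteq> X \<and> X \<inter> J = {}} \<and> Y \<in> {X. Q X}"
      using QY by simp
  qed (use A fin in auto)
  thus ?thesis
    unfolding split[symmetric] Q_eq using fin IJ(3) p by (simp add: prob_random_subset_prescribed)
qed

lemma prob_random_subset_cylinder:
  assumes "finite A" "I \<subseteq> A" "J \<subseteq> A" "I \<inter> J = {}" "0 \<le> p" "p \<le> 1"
  shows "measure_pmf.prob (random_subset A p) {X. I \<subseteq> X \<and> X \<inter> J = {}} = p ^ card I * (1 - p) ^ card J"
  using prob_random_subset_indep[OF assms, of "{}" "\<lambda>_. True"] by (simp add: measure_pmf.prob_space[simplified])

lemma expectation_card_pmf:
  assumes "finite (set_pmf M)" "finite T"
  shows "measure_pmf.expectation M (\<lambda>x. real (card {t \<in> T. P t x})) = (\<Sum>t\<in>T. measure_pmf.prob M {x. P t x})"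
proof -
  have "real (card {t \<in> T. P t x}) = (\<Sum>t\<in>T. indicator {x. P t x} x)" for x
    using assms(2) by (simp add: indicator_def sum.If_cases Int_def conj_commute)
  thus ?thesis
    using assms by (simp add: Bochner_Integration.integral_sum integrable_measure_pmf_finite)
qed

text \<open>
  By Chebyshev \<open>X\<close> exceeds half its mean up to probability \<open>4 \<delta>\<close>, and by Markov \<open>Y\<close> stays below
  that value up to probability \<open>2 \<eta>\<close>.
\<close>

lemma prob_le_by_second_moment:
  fixes X Y :: "'a \<Rightarrow> real"
  assumes fin: "finite (set_pmf M)" and pos: "measure_pmf.expectation M X > 0"
    and X2: "measure_pmf.expectation M (\<lambda>x. (X x)\<^sup>2) \<le> (1 + \<delta>) * (measure_pmf.expectation M X)\<^sup>2"
    and Y: "\<And>x. Y x \<ge> 0" "measure_pmf.expectation M Y \<le> \<eta> * measure_pmf.expectation M X"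
  shows "measure_pmf.prob M {x. X x \<le> Y x} \<le> 4 * \<delta> + 2 * \<eta>"
proof -
  define \<mu> where "\<mu> = measure_pmf.expectation M X"
  have int: "integrable M f" for f :: "'a \<Rightarrow> real"
    using fin by (rule integrable_measure_pmf_finite)
  have var: "measure_pmf.variance M X \<le> \<delta> * \<mu>\<^sup>2"
    unfolding measure_pmf.variance_eq[OF int int] using X2 by (simp add: \<mu>_def algebra_simps)
  have "measure_pmf.prob M {x. X x \<le> Y x}
      \<le> measure_pmf.prob M ({x. \<mu> / 2 \<le> \<bar>X x - \<mu>\<bar>} \<union> {x. \<mu> / 2 \<le> Y x})"
    by (intro measure_pmf.finite_measure_mono) (auto simp: abs_if field_simps)
  also have "\<dots> \<le> measure_pmf.prob M {x. \<mu> / 2 \<le> \<bar>X x - \<mu>\<bar>} + measure_pmf.prob M {x. \<mu> / 2 \<le> Y x}"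
    by (rule measure_Un_le) auto
  also have "measure_pmf.prob M {x. \<mu> / 2 \<le> \<bar>X x - \<mu>\<bar>} \<le> 4 * \<delta>"
  proof -
    have "measure_pmf.prob M {x. \<mu> / 2 \<le> \<bar>X x - \<mu>\<bar>} \<le> measure_pmf.variance M X / (\<mu> / 2)\<^sup>2"
      using measure_pmf.Chebyshev_inequality[of X M "\<mu> / 2"] int pos by (simp add: \<mu>_def)
    also have "\<dots> \<le> \<delta> * \<mu>\<^sup>2 / (\<mu> / 2)\<^sup>2" using var by (intro divide_right_mono) auto
    also have "\<dots> = 4 * \<delta>" using pos by (simp add: \<mu>_def[symmetric] field_simps power2_eq_square)
    finally show ?thesis .
  qed
  also have "measure_pmf.prob M {x. \<mu> / 2 \<le> Y x} \<le> 2 * \<eta>"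
  proof -
    have "measure_pmf.prob M {x. \<mu> / 2 \<le> Y x} \<le> measure_pmf.expectation M Y / (\<mu> / 2)"
      using integral_Markov_inequality_measure[OF int, of "{}" Y "\<mu> / 2"] Y(1) pos by (simp add: \<mu>_def)
    also have "\<dots> \<le> \<eta> * \<mu> / (\<mu> / 2)"
      using Y(2) pos by (intro divide_right_mono) (auto simp: \<mu>_def)
    also have "\<dots> = 2 * \<eta>" using pos by (simp add: \<mu>_def[symmetric])
    finally show ?thesis .
  qed
  finally show ?thesis by simp
qed

section \<open>The expected number of pendant paths\<close>

definition triples :: "nat \<Rightarrow> (nat \<times> nat \<times> nat) set" where
  "triples n = (SIGMA v:{..<n}. SIGMA u:{..<n} - {v}. {..<n} - {v, u})"

lemma finite_triples [simp]: "finite (triples n)"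
  by (auto simp: triples_def)

lemma mem_triples: "(v, u, w) \<in> triples n \<longleftrightarrow> v < n \<and> u < n \<and> w < n \<and> distinct [v, u, w]"
  by (auto simp: triples_def)

lemma card_pairs: "card (SIGMA v:{..<n}. {..<n} - {v}) = n * (n - 1)"
  by (simp add: card_SigmaI)

text \<open>
  The probability that \<open>v - u - w\<close> is pendant and attached to a small closed set is bounded only
  after summation over \<open>w\<close>, for fixed \<open>v\<close> and \<open>u\<close>; hence this order of summation.
\<close>

lemma sum_triples:
  "(\<Sum>(v, u, w)\<in>triples n. f v u w)
    = (\<Sum>(v, u)\<in>(SIGMA v:{..<n}. {..<n} - {v}). \<Sum>w\<in>{..<n} - {v, u}. f v u w)"
  unfolding triples_def by (simp add: sum.Sigma[symmetric])

lemma card_triples: "card (triples n) = n * (n - 1) * (n - 2)"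
  unfolding triples_def by (simp add: card_Diff_subset numeral_2_eq_2)

lemma finite_possible_edges [simp]: "finite (possible_edges n)"
  by (rule finite_subset[of _ "Pow {..<n}"]) (auto simp: possible_edges_def)

definition incident_edges :: "nat \<Rightarrow> nat set \<Rightarrow> nat set set" where
  "incident_edges n K = {e \<in> possible_edges n. e \<inter> K \<noteq> {}}"

lemma incident_edges_subset: "incident_edges n K \<subseteq> possible_edges n"
  by (auto simp: incident_edges_def)

lemma card_incident_edges:
  assumes "K \<subseteq> {..<n}"
  shows "card (incident_edges n K) = (n choose 2) - ((n - card K) choose 2)"
proof -
  have "incident_edges n K = possible_edges n - {e. e \<subseteq> {..<n} - K \<and> card e = 2}"
    by (auto simp: incident_edges_def possible_edges_def)
  moreover have "{e. e \<subseteq> {..<n} - K \<and> card e = 2} \<subseteq> possible_edges n"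
    by (auto simp: possible_edges_def)
  moreover have "card ({..<n} - K) = n - card K"
    using assms by (simp add: card_Diff_subset finite_subset)
  ultimately show ?thesis
    by (simp add: card_Diff_subset finite_subset n_subsets) (simp add: possible_edges_def n_subsets)
qed

lemma card_incident_edges_pair:
  assumes "v < n" "u < n" "v \<noteq> u"
  shows "card (incident_edges n {v, u}) = 2 * n - 3"
proof -
  have "2 \<le> n" using assms by linarith
  then obtain k where "n = k + 2" using le_Suc_ex[of 2 n] by auto
  moreover have "(k + 2 choose 2) = (k choose 2) + 2 * k + 1"
    by (simp add: numeral_eq_Suc)
  ultimately show ?thesis using assms by (simp add: card_incident_edges)
qed

lemma card_incident_edges_four:
  assumes "K \<subseteq> {..<n}" "card K = 4"
  shows "card (incident_edges n K) = 4 * n - 10"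
proof -
  have "4 \<le> n" using card_mono[of "{..<n}" K] assms by simp
  then obtain k where "n = k + 4" using le_Suc_ex[of 4 n] by auto
  moreover have "(k + 4 choose 2) = (k choose 2) + 4 * k + 6"
    by (simp add: numeral_eq_Suc)
  ultimately show ?thesis using assms by (simp add: card_incident_edges)
qed

lemma pair_in_possible_edges [simp]: "{a, b} \<in> possible_edges n \<longleftrightarrow> a \<noteq> b \<and> a < n \<and> b < n"
  by (auto simp: possible_edges_def card_insert_if)

lemma possible_edgesE:
  assumes "e \<in> possible_edges n" "x \<in> e"
  obtains y where "e = {x, y}" "x \<noteq> y"
  using assms unfolding possible_edges_def card_2_iff by auto

definition path_edges :: "nat \<Rightarrow> nat \<Rightarrow> nat \<Rightarrow> nat set set" where
  "path_edges v u w = {{v, u}, {u, w}}"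

lemma card_path_edges: "distinct [v, u, w] \<Longrightarrow> card (path_edges v u w) = 2"
  by (auto simp: path_edges_def doubleton_eq_iff)

text \<open>
  Being pendant prescribes the state of every possible edge that touches \<open>v\<close> or \<open>u\<close>: the two edges
  of the path are present and all others are absent.
\<close>

lemma pendant_iff_cylinder:
  assumes E: "E \<subseteq> possible_edges n" and t: "(v, u, w) \<in> triples n"
  shows "pendant E v u w \<longleftrightarrow>
    path_edges v u w \<subseteq> E \<and> E \<inter> (incident_edges n {v, u} - path_edges v u w) = {}"
proof
  assume "pendant E v u w"
  hence p: "{v, x} \<in> E \<longleftrightarrow> x = u" "{u, x} \<in> E \<longleftrightarrow> x = v \<or> x = w" for x
    by (auto simp: pendant_def)
  have "e \<in> path_edges v u w" if e: "e \<in> E" "e \<inter> {v, u} \<noteq> {}" for e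
  proof -
    have "e \<in> possible_edges n" using e E by auto
    moreover obtain x where x: "x \<in> e" "x = v \<or> x = u" using e by auto
    ultimately obtain y where "e = {x, y}" by (metis possible_edgesE)
    thus ?thesis using p[of y] e(1) x by (auto simp: path_edges_def insert_commute)
  qed
  moreover have "path_edges v u w \<subseteq> E"
    using p(1)[of u] p(2)[of w] by (simp add: path_edges_def)
  ultimately show "path_edges v u w \<subseteq> E \<and> E \<inter> (incident_edges n {v, u} - path_edges v u w) = {}"
    by (auto simp: incident_edges_def)
next
  assume *: "path_edges v u w \<subseteq> E \<and> E \<inter> (incident_edges n {v, u} - path_edges v u w) = {}"
  hence inc: "e \<in> path_edges v u w" if "e \<in> E" "e \<inter> {v, u} \<noteq> {}" for e
    using that E by (auto simp: incident_edges_def)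
  have d: "distinct [v, u, w]" using t by (simp add: mem_triples)
  have "{v, x} \<in> E \<longleftrightarrow> x = u" for x
    using * inc[of "{v, x}"] d by (auto simp: path_edges_def doubleton_eq_iff)
  moreover have "{u, x} \<in> E \<longleftrightarrow> x = v \<or> x = w" for x
    using * inc[of "{u, x}"] d by (auto simp: path_edges_def doubleton_eq_iff insert_commute)
  ultimately show "pendant E v u w" using d by (auto simp: pendant_def)
qed

lemma path_edges_subset:
  assumes "(v, u, w) \<in> triples n"
  shows "path_edges v u w \<subseteq> incident_edges n {v, u}" "path_edges v u w \<subseteq> possible_edges n"
  using assms by (auto simp: path_edges_def incident_edges_def mem_triples)

text \<open>
  Of the \<open>2 n - 3\<close> possible edges that touch \<open>v\<close> or \<open>u\<close>, two are the edges of the path.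
\<close>

lemma card_forbidden_edges:
  assumes "(v, u, w) \<in> triples n"
  shows "card (incident_edges n {v, u} - path_edges v u w) = 2 * n - 5"
proof -
  have "finite (path_edges v u w)" by (simp add: path_edges_def)
  thus ?thesis
    using assms path_edges_subset[OF assms]
    by (simp add: card_Diff_subset mem_triples card_incident_edges_pair card_path_edges)
qed

locale random_edges =
  fixes n :: nat and p :: real
  assumes p: "0 < p" "p < 1"
begin

abbreviation M where "M \<equiv> random_subset (possible_edges n) p"

definition pendant_prob where "pendant_prob = p ^ 2 * (1 - p) ^ (2 * n - 5)"

lemma prob_cong_edges:
  assumes "\<And>E. E \<subseteq> possible_edges n \<Longrightarrow> E \<in> F \<longleftrightarrow> E \<in> F'"
  shows "measure_pmf.prob M F = measure_pmf.prob M F'"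
proof -
  have "F \<inter> set_pmf M = F' \<inter> set_pmf M"
    using assms set_random_subset[of "possible_edges n" p] by blast
  thus ?thesis by (metis measure_Int_set_pmf)
qed

lemma prob_pendant_indep:
  assumes t: "(v, u, w) \<in> triples n" and D: "D \<inter> incident_edges n {v, u} = {}"
    and Q: "\<And>X Y. X \<inter> D = Y \<inter> D \<Longrightarrow> Q X \<longleftrightarrow> Q Y"
  shows "measure_pmf.prob M {E. pendant E v u w \<and> Q E} = pendant_prob * measure_pmf.prob M {E. Q E}"
proof -
  let ?I = "path_edges v u w"
  let ?J = "incident_edges n {v, u} - ?I"
  have "measure_pmf.prob M {E. pendant E v u w \<and> Q E}
      = measure_pmf.prob M {E. ?I \<subseteq> E \<and> E \<inter> ?J = {} \<and> Q E}"
    by (rule prob_cong_edges) (simp add: pendant_iff_cylinder[OF _ t])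
  also have "\<dots> = p ^ card ?I * (1 - p) ^ card ?J * measure_pmf.prob M {E. Q E}"
  proof (rule prob_random_subset_indep[where D = D])
    show "?I \<subseteq> possible_edges n" by (rule path_edges_subset[OF t])
    show "?J \<subseteq> possible_edges n" using incident_edges_subset by auto
    show "D \<inter> (?I \<union> ?J) = {}" using D path_edges_subset[OF t] by auto
    show "Q X \<longleftrightarrow> Q Y" if "X \<inter> D = Y \<inter> D" for X Y using that by (rule Q)
  qed (use p in auto)
  also have "p ^ card ?I * (1 - p) ^ card ?J = pendant_prob"
    using t by (simp add: pendant_prob_def card_forbidden_edges card_path_edges mem_triples)
  finally show ?thesis .
qed

lemma prob_pendant:
  assumes "(v, u, w) \<in> triples n"
  shows "measure_pmf.prob M {E. pendant E v u w} = pendant_prob"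
  using prob_pendant_indep[OF assms, of "{}" "\<lambda>_. True"] by (simp add: measure_pmf.prob_space[simplified])

definition pendant_count :: "nat set set \<Rightarrow> real" where
  "pendant_count E = real (card {t \<in> triples n. case t of (v, u, w) \<Rightarrow> pendant E v u w})"

definition small_pendant_count :: "nat set set \<Rightarrow> real" where
  "small_pendant_count E = real (card {t \<in> triples n. case t of (v, u, w) \<Rightarrow>
     pendant E v u w \<and> in_small_closed E ({..<n} - {v, u}) n w})"

lemma fin_M: "finite (set_pmf M)"
  by (rule finite_set_random_subset) simp

lemma expectation_pendant_count:
  "measure_pmf.expectation M pendant_count = real (n * (n - 1) * (n - 2)) * pendant_prob"
proof -
  have "measure_pmf.expectation M pendant_count
      = (\<Sum>t\<in>triples n. measure_pmf.prob M {E. case t of (v, u, w) \<Rightarrow> pendant E v u w})"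
    unfolding pendant_count_def by (rule expectation_card_pmf[OF fin_M finite_triples])
  also have "\<dots> = (\<Sum>t\<in>triples n. pendant_prob)"
    by (intro sum.cong) (auto simp: prob_pendant)
  finally show ?thesis by (simp add: card_triples)
qed

end

section \<open>The second moment of the number of pendant paths\<close>

text \<open>
  For separated paths no edge of one path touches the first two vertices of the other. The two
  pendant conditions then never contradict each other, and they overlap only in the four absent
  edges between \<open>{v, u}\<close> and \<open>{v', u'}\<close>.
\<close>

definition separated :: "nat \<times> nat \<times> nat \<Rightarrow> nat \<times> nat \<times> nat \<Rightarrow> bool" where
  "separated = (\<lambda>(v, u, w) (v', u', w').
     {v, u} \<inter> {v', u'} = {} \<and> w \<notin> {v', u'} \<and> w' \<notin> {v, u})"

text \<open>
  Two different pendant paths that are not separated lie in a component that is itself a path: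
  either \<open>v - u - w\<close>, read in both directions, or \<open>v - u - w - v'\<close>, read from both ends.
\<close>

lemma pendant_not_separated_cases:
  assumes "pendant E v u w" "pendant E v' u' w'" "\<not> separated (v, u, w) (v', u', w')"
  shows "(v', u', w') = (v, u, w) \<or> (v', u', w') = (w, u, v) \<or> (u', w') = (w, u)"
proof -
  have t: "v \<noteq> u" "v \<noteq> w" "u \<noteq> w" "\<And>x. {v, x} \<in> E \<longleftrightarrow> x = u" "\<And>x. {u, x} \<in> E \<longleftrightarrow> x = v \<or> x = w"
    using assms(1) by (auto simp: pendant_def)
  have t': "v' \<noteq> u'" "v' \<noteq> w'" "u' \<noteq> w'" "\<And>x. {v', x} \<in> E \<longleftrightarrow> x = u'" "\<And>x. {u', x} \<in> E \<longleftrightarrow> x = v' \<or> x = w'"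
    using assms(2) by (auto simp: pendant_def)
  have edge: "{w, u} \<in> E" "{w', u'} \<in> E" "{u, v} \<in> E" "{u', v'} \<in> E"
    using t t' by (metis insert_commute)+
  have neq: "v' \<noteq> u" "u' \<noteq> v" using t t' by metis+
  have same_u: "(v', u', w') = (v, u, w) \<or> (v', u', w') = (w, u, v)" if "u' = u"
  proof -
    have "v' = v \<or> v' = w" "w' = v \<or> w' = w" using t(5) t'(5) that by metis+
    thus ?thesis using t'(2) that by auto
  qed
  consider "v' = v" | "u' = u" | "w = v'" | "w = u'" | "w' = v" | "w' = u"
    using assms(3) neq unfolding separated_def by auto
  thus ?thesis
  proof cases
    case 1
    hence "u' = u" using t(4) t'(4) by metis
    thus ?thesis using same_u by blast
  next
    case 2
    thus ?thesis using same_u by blast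
  next
    case 3
    hence "u' = u" using t'(4) edge(1) by metis
    thus ?thesis using same_u by blast
  next
    case 4
    hence "w' = u" using t'(5) edge(1) neq by metis
    thus ?thesis using 4 by simp
  next
    case 5
    hence "u' = u" using t(4) edge(2) by metis
    thus ?thesis using same_u by blast
  next
    case 6
    hence "u' = w" using t(5) edge(2) neq by metis
    thus ?thesis using 6 by simp
  qed
qed

lemma pendant_leaf_unique:
  assumes "pendant E z u w" "pendant E z' u w"
  shows "z = z'"
  using assms unfolding pendant_def distinct.simps by (metis insertCI list.set(2))

text \<open>
  The three possibilities are the path itself, its reversal, and a path \<open>z - w - u\<close>, where \<open>z\<close> is
  determined as the other neighbour of \<open>w\<close>.
\<close>

lemma card_not_separated:
  assumes "pendant E v u w"
  shows "card {t' \<in> triples n. (case t' of (v', u', w') \<Rightarrow> pendant E v' u' w') \<and> \<not> separated (v, u, w) t'} \<le> 3"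
proof -
  (* The paths read from the other end when the component is a path on four vertices. *)
  define Z where "Z = {(z, w, u) | z. (z, w, u) \<in> triples n \<and> pendant E z w u}"
  have "Z \<subseteq> triples n" by (auto simp: Z_def)
  hence "finite Z" by (rule finite_subset) simp
  moreover have "\<forall>x\<in>Z. \<forall>y\<in>Z. x = y" unfolding Z_def using pendant_leaf_unique by blast
  ultimately have "card Z \<le> 1" using card_le_Suc0_iff_eq[of Z] by simp
  define S where "S = {t' \<in> triples n. (case t' of (v', u', w') \<Rightarrow> pendant E v' u' w') \<and> \<not> separated (v, u, w) t'}"
  have "S \<subseteq> {(v, u, w), (w, u, v)} \<union> Z"
  proof
    fix t' assume "t' \<in> S"
    moreover obtain v' u' w' where t': "t' = (v', u', w')" by (cases t')
    ultimately show "t' \<in> {(v, u, w), (w, u, v)} \<union> Z"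
      using pendant_not_separated_cases[OF assms, of v' u' w'] by (auto simp: S_def Z_def)
  qed
  hence "card S \<le> card ({(v, u, w), (w, u, v)} \<union> Z)" using \<open>finite Z\<close> by (intro card_mono) auto
  moreover have "card ({(v, u, w), (w, u, v)} \<union> Z) \<le> card {(v, u, w), (w, u, v)} + card Z"
    by (rule card_Un_le)
  moreover have "card {(v, u, w), (w, u, v)} \<le> 2" by (rule card_insert_le_m1) simp_all
  moreover note \<open>card Z \<le> 1\<close>
  ultimately have "card S \<le> 3" by linarith
  thus ?thesis unfolding S_def .
qed

lemma incident_edges_Un: "incident_edges n (K \<union> L) = incident_edges n K \<union> incident_edges n L"
  by (auto simp: incident_edges_def)

context random_edges
begin

definition separated_pairs where
  "separated_pairs = {(t, t') \<in> triples n \<times> triples n. separated t t'}"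

text \<open>
  There are \<open>4 n - 10\<close> possible edges that touch the four vertices \<open>v\<close>, \<open>u\<close>, \<open>v'\<close>, \<open>u'\<close>,
  and four of them are prescribed to be present.
\<close>

lemma prob_separated_pair:
  assumes "((v, u, w), (v', u', w')) \<in> separated_pairs"
  shows "measure_pmf.prob M {E. pendant E v u w \<and> pendant E v' u' w'} = p ^ 4 * (1 - p) ^ (4 * n - 14)"
proof -
  have t: "(v, u, w) \<in> triples n" and t': "(v', u', w') \<in> triples n"
    and sep: "{v, u} \<inter> {v', u'} = {}" "w \<notin> {v', u'}" "w' \<notin> {v, u}"
    using assms by (auto simp: separated_pairs_def separated_def)
  let ?I = "path_edges v u w" and ?I' = "path_edges v' u' w'"
  let ?N = "incident_edges n {v, u}" and ?N' = "incident_edges n {v', u'}"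
  have I: "?I \<subseteq> ?N" "?I \<inter> ?N' = {}" and I': "?I' \<subseteq> ?N'" "?I' \<inter> ?N = {}"
    using t t' sep path_edges_subset(1) by (auto simp: path_edges_def incident_edges_def mem_triples)
  have fin: "finite ?I" "finite ?I'" by (auto simp: path_edges_def)
  have "measure_pmf.prob M {E. pendant E v u w \<and> pendant E v' u' w'}
     = measure_pmf.prob M {E. ?I \<union> ?I' \<subseteq> E \<and> E \<inter> ((?N \<union> ?N') - (?I \<union> ?I')) = {}}"
  proof (rule prob_cong_edges)
    fix E assume "E \<subseteq> possible_edges n"
    note iff = pendant_iff_cylinder[OF this t] pendant_iff_cylinder[OF this t']
    have "(?N \<union> ?N') - (?I \<union> ?I') = (?N - ?I) \<union> (?N' - ?I')" using I I' by blast
    thus "E \<in> {E. pendant E v u w \<and> pendant E v' u' w'}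
        \<longleftrightarrow> E \<in> {E. ?I \<union> ?I' \<subseteq> E \<and> E \<inter> ((?N \<union> ?N') - (?I \<union> ?I')) = {}}"
      using iff by auto
  qed
  also have "\<dots> = p ^ card (?I \<union> ?I') * (1 - p) ^ card ((?N \<union> ?N') - (?I \<union> ?I'))"
    using path_edges_subset(2)[OF t] path_edges_subset(2)[OF t'] p
      incident_edges_subset[of n "{v, u}"] incident_edges_subset[of n "{v', u'}"]
    by (intro prob_random_subset_cylinder) auto
  also have card_I: "card (?I \<union> ?I') = 4"
    using I I' fin t t' by (subst card_Un_disjoint) (auto simp: card_path_edges mem_triples)
  also have "card ((?N \<union> ?N') - (?I \<union> ?I')) = 4 * n - 14"
  proof -
    have "card (incident_edges n ({v, u} \<union> {v', u'})) = 4 * n - 10"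
      using t t' sep by (intro card_incident_edges_four) (auto simp: mem_triples card_insert_if)
    hence "card (?N \<union> ?N') = 4 * n - 10" unfolding incident_edges_Un .
    thus ?thesis using I I' fin card_I by (subst card_Diff_subset) auto
  qed
  finally show ?thesis .
qed

lemma pendant_count_square_le:
  "(pendant_count E)\<^sup>2 \<le> 3 * pendant_count E
    + real (card {x \<in> separated_pairs. case x of ((v, u, w), (v', u', w')) \<Rightarrow> pendant E v u w \<and> pendant E v' u' w'})"
proof -
  define P where "P = {t \<in> triples n. case t of (v, u, w) \<Rightarrow> pendant E v u w}"
  define S where "S = {x \<in> separated_pairs. case x of ((v, u, w), (v', u', w')) \<Rightarrow> pendant E v u w \<and> pendant E v' u' w'}"
  have finP: "finite P" by (simp add: P_def)
  have finS: "finite S"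
    by (rule finite_subset[of _ "triples n \<times> triples n"]) (auto simp: S_def separated_pairs_def)
  have "P \<times> P \<subseteq> (SIGMA t:P. {t' \<in> P. \<not> separated t t'}) \<union> S"
    by (auto simp: P_def S_def separated_pairs_def)
  hence "card (P \<times> P) \<le> card ((SIGMA t:P. {t' \<in> P. \<not> separated t t'}) \<union> S)"
    using finP finS by (intro card_mono) auto
  also have "\<dots> \<le> card (SIGMA t:P. {t' \<in> P. \<not> separated t t'}) + card S"
    by (rule card_Un_le)
  also have "card (SIGMA t:P. {t' \<in> P. \<not> separated t t'}) = (\<Sum>t\<in>P. card {t' \<in> P. \<not> separated t t'})"
    using finP by (simp add: card_SigmaI)
  also have "\<dots> \<le> (\<Sum>t\<in>P. 3)"
  proof (rule sum_mono)
    fix t assume "t \<in> P"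
    then obtain v u w where t: "t = (v, u, w)" "pendant E v u w" by (auto simp: P_def)
    have "{t' \<in> P. \<not> separated t t'} = {t' \<in> triples n. (case t' of (v', u', w') \<Rightarrow> pendant E v' u' w') \<and> \<not> separated (v, u, w) t'}"
      by (auto simp: P_def t)
    thus "card {t' \<in> P. \<not> separated t t'} \<le> 3" using card_not_separated[OF t(2)] by simp
  qed
  finally have "card P * card P \<le> 3 * card P + card S" by (simp add: card_cartesian_product)
  hence "real (card P * card P) \<le> real (3 * card P + card S)" by (rule of_nat_mono)
  thus ?thesis
    unfolding pendant_count_def P_def[symmetric] S_def[symmetric] by (simp add: power2_eq_square)
qed

text \<open>
  The factor \<open>1 / (1 - p)\<^sup>4\<close> accounts for the four absent edges that the two conditions of a
  separated pair share; the remaining pairs contribute at most \<open>3 \<mu>\<close>.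
\<close>

lemma expectation_pendant_count_square:
  assumes n: "4 \<le> n"
  defines "\<mu> \<equiv> measure_pmf.expectation M pendant_count"
  shows "measure_pmf.expectation M (\<lambda>E. (pendant_count E)\<^sup>2) \<le> 3 * \<mu> + \<mu>\<^sup>2 / (1 - p) ^ 4"
proof -
  let ?S = "\<lambda>E. real (card {x \<in> separated_pairs. case x of ((v, u, w), (v', u', w')) \<Rightarrow> pendant E v u w \<and> pendant E v' u' w'})"
  have int: "integrable M f" for f :: "nat set set \<Rightarrow> real"
    using fin_M by (rule integrable_measure_pmf_finite)
  have finS: "finite separated_pairs"
    by (rule finite_subset[of _ "triples n \<times> triples n"]) (auto simp: separated_pairs_def)
  have "measure_pmf.expectation M (\<lambda>E. (pendant_count E)\<^sup>2)
      \<le> measure_pmf.expectation M (\<lambda>E. 3 * pendant_count E + ?S E)"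
    using int pendant_count_square_le by (intro integral_mono) auto
  also have "\<dots> = 3 * \<mu> + measure_pmf.expectation M ?S"
    by (simp add: int \<mu>_def)
  also have "measure_pmf.expectation M ?S = (\<Sum>x\<in>separated_pairs.
      measure_pmf.prob M {E. case x of ((v, u, w), (v', u', w')) \<Rightarrow> pendant E v u w \<and> pendant E v' u' w'})"
    by (rule expectation_card_pmf[OF fin_M finS])
  also have "\<dots> = (\<Sum>x\<in>separated_pairs. p ^ 4 * (1 - p) ^ (4 * n - 14))"
    by (intro sum.cong) (auto simp: prob_separated_pair split: prod.split)
  also have "\<dots> = real (card separated_pairs) * (p ^ 4 * (1 - p) ^ (4 * n - 14))" by simp
  also have "\<dots> \<le> real (card (triples n) * card (triples n)) * (p ^ 4 * (1 - p) ^ (4 * n - 14))"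
  proof -
    have "card separated_pairs \<le> card (triples n \<times> triples n)"
      by (intro card_mono) (auto simp: separated_pairs_def)
    hence "real (card separated_pairs) \<le> real (card (triples n) * card (triples n))"
      unfolding card_cartesian_product by (rule of_nat_mono)
    thus ?thesis using p by (intro mult_right_mono) auto
  qed
  also have "\<dots> = \<mu>\<^sup>2 / (1 - p) ^ 4"
  proof -
    have "(1 - p) ^ (4 * n - 14) * (1 - p) ^ 4 = ((1 - p) ^ (2 * n - 5))\<^sup>2"
    proof -
      have "4 * n - 14 + 4 = (2 * n - 5) * 2" using n by simp
      thus ?thesis by (metis power_add power_mult)
    qed
    moreover have "pendant_prob\<^sup>2 = p ^ 4 * ((1 - p) ^ (2 * n - 5))\<^sup>2"
      by (simp add: pendant_prob_def power_mult_distrib flip: power_mult)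
    ultimately have "p ^ 4 * (1 - p) ^ (4 * n - 14) = pendant_prob\<^sup>2 / (1 - p) ^ 4"
      using p by (simp add: eq_divide_eq mult.assoc)
    thus ?thesis
      unfolding \<mu>_def expectation_pendant_count card_triples by (simp add: power2_eq_square)
  qed
  finally show ?thesis by simp
qed

end

section \<open>Pendant paths attached to small closed sets\<close>

lemma in_small_closed_restrict:
  assumes "X \<inter> {e. e \<subseteq> U} = Y \<inter> {e. e \<subseteq> U}"
  shows "in_small_closed X U k w \<longleftrightarrow> in_small_closed Y U k w"
proof -
  have "{a, b} \<in> X \<longleftrightarrow> {a, b} \<in> Y" if "a \<in> U" "b \<in> U" for a b
    using assms that by (simp add: set_eq_iff) blast
  hence "closed_in X U S \<longleftrightarrow> closed_in Y U S" for S
    unfolding closed_in_def by blast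
  thus ?thesis unfolding in_small_closed_def by simp
qed

text \<open>
  Used with \<open>K = {v, u}\<close>: if \<open>w\<close> lies in a small closed set of the whole graph, it also does so
  in the graph without \<open>v\<close> and \<open>u\<close>, which is independent of \<open>v - u - w\<close> being pendant.
\<close>

lemma in_small_closed_delete:
  assumes "in_small_closed E U k w" "w \<notin> K" "finite U"
  shows "in_small_closed E (U - K) k w"
proof -
  obtain S where S: "closed_in E U S" "w \<in> S" "2 * card S \<le> k"
    using assms(1) by (auto simp: in_small_closed_def)
  have "closed_in E (U - K) (S - K)" using S(1) by (auto simp: closed_in_def)
  moreover have "finite S" using S(1) assms(3) by (auto simp: closed_in_def intro: finite_subset)
  hence "card (S - K) \<le> card S" by (intro card_mono) auto
  ultimately show ?thesis using S assms(2) unfolding in_small_closed_def by (intro exI[of _ "S - K"]) auto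
qed

context random_edges
begin

lemma prob_closed_in:
  assumes U: "U \<subseteq> {..<n}" and S: "S \<subseteq> U"
  shows "measure_pmf.prob M {E. closed_in E U S} = (1 - p) ^ (card S * card (U - S))"
proof -
  define J where "J = (\<lambda>(a, b). {a, b}) ` (S \<times> (U - S))"
  have fin: "finite S" "finite (U - S)" using U S by (auto intro: finite_subset)
  have "inj_on (\<lambda>(a, b). {a, b}) (S \<times> (U - S))"
    by (auto simp: inj_on_def doubleton_eq_iff)
  hence card_J: "card J = card S * card (U - S)"
    by (simp add: J_def card_image card_cartesian_product)
  have lt: "a < n" if "a \<in> U" for a using U that by auto
  have J: "J \<subseteq> possible_edges n" by (auto simp: J_def intro: lt lt[OF subsetD[OF S]])
  have "{E. closed_in E U S} = {E. {} \<subseteq> E \<and> E \<inter> J = {}}"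
    using S by (auto simp: closed_in_def J_def)
  thus ?thesis
    using prob_random_subset_cylinder[of "possible_edges n" "{}" J p] J p by (simp add: card_J)
qed

text \<open>
  A union bound: there are at most \<open>2\<^sup>n\<close> sets, and each one with between \<open>m\<close> and \<open>n / 2\<close> vertices
  has at least \<open>m (n div 2 - 2)\<close> possible edges to its complement. The 2 is subtracted because
  two vertices are deleted from the graph.
\<close>

definition cut_bound :: "nat \<Rightarrow> real" where
  "cut_bound m = 2 ^ n * (1 - p) ^ (m * (n div 2 - 2))"

lemma prob_large_closed:
  assumes U: "U \<subseteq> {..<n}" "n \<le> card U + 2"
  shows "measure_pmf.prob M {E. \<exists>S. closed_in E U S \<and> 2 * card S \<le> n \<and> m \<le> card S} \<le> cut_bound m"
proof -
  define F where "F = {S. S \<subseteq> U \<and> 2 * card S \<le> n \<and> m \<le> card S}"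
  have finU: "finite U" using U(1) by (rule finite_subset) simp
  have FU: "F \<subseteq> Pow U" by (auto simp: F_def)
  hence finF: "finite F" using finU by (auto intro: finite_subset)
  have "{E. \<exists>S. closed_in E U S \<and> 2 * card S \<le> n \<and> m \<le> card S} = (\<Union>S\<in>F. {E. closed_in E U S})"
    by (auto simp: F_def closed_in_def)
  hence "measure_pmf.prob M {E. \<exists>S. closed_in E U S \<and> 2 * card S \<le> n \<and> m \<le> card S}
      \<le> (\<Sum>S\<in>F. measure_pmf.prob M {E. closed_in E U S})"
    using finF by (simp add: measure_pmf.finite_measure_subadditive_finite)
  also have "\<dots> \<le> (\<Sum>S\<in>F. (1 - p) ^ (m * (n div 2 - 2)))"
  proof (rule sum_mono)
    fix S assume S: "S \<in> F"
    hence "card (U - S) = card U - card S"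
      using finU by (intro card_Diff_subset) (auto simp: F_def intro: finite_subset)
    hence "n div 2 - 2 \<le> card (U - S)" using S U(2) by (auto simp: F_def)
    hence "m * (n div 2 - 2) \<le> card S * card (U - S)" using S by (intro mult_le_mono) (auto simp: F_def)
    hence "(1 - p) ^ (card S * card (U - S)) \<le> (1 - p) ^ (m * (n div 2 - 2))"
      using p by (intro power_decreasing) auto
    moreover have "S \<subseteq> U" using S by (simp add: F_def)
    ultimately show "measure_pmf.prob M {E. closed_in E U S} \<le> (1 - p) ^ (m * (n div 2 - 2))"
      by (simp add: prob_closed_in[OF U(1)])
  qed
  also have "\<dots> = real (card F) * (1 - p) ^ (m * (n div 2 - 2))" by simp
  also have "\<dots> \<le> cut_bound m"
  proof -
    have "card F \<le> 2 ^ card U" using card_mono[OF _ FU] finU by (simp add: card_Pow)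
    also have "\<dots> \<le> 2 ^ n" using card_mono[OF _ U(1)] by (intro power_increasing) auto
    finally have "real (card F) \<le> 2 ^ n" by (metis of_nat_le_iff of_nat_numeral of_nat_power)
    thus ?thesis unfolding cut_bound_def using p by (intro mult_right_mono) auto
  qed
  finally show ?thesis .
qed

text \<open>
  The sum is the expected number of vertices in small closed sets. This number is at most \<open>m\<close>
  unless there is a closed set of intermediate size, in which case it is at most \<open>n\<close>.
\<close>

lemma sum_prob_in_small_closed:
  assumes U: "U \<subseteq> {..<n}" "n \<le> card U + 2" and m: "4 * m \<le> n"
  shows "(\<Sum>w\<in>U. measure_pmf.prob M {E. in_small_closed E U n w}) \<le> real m + real n * cut_bound m"
proof -
  define B where "B = {E. \<exists>S. closed_in E U S \<and> 2 * card S \<le> n \<and> m \<le> card S}"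
  have finU: "finite U" using U(1) by (rule finite_subset) simp
  have int: "integrable M f" for f :: "nat set set \<Rightarrow> real"
    using fin_M by (rule integrable_measure_pmf_finite)
  have "(\<Sum>w\<in>U. measure_pmf.prob M {E. in_small_closed E U n w})
      = measure_pmf.expectation M (\<lambda>E. real (card {w \<in> U. in_small_closed E U n w}))"
    by (rule expectation_card_pmf[OF fin_M finU, symmetric])
  also have "\<dots> \<le> measure_pmf.expectation M (\<lambda>E. real m + real n * indicator B E)"
  proof (intro integral_mono int)
    fix E
    show "real (card {w \<in> U. in_small_closed E U n w}) \<le> real m + real n * indicator B E"
    proof (cases "E \<in> B")
      case True
      have "card {w \<in> U. in_small_closed E U n w} \<le> card {..<n}"
        using U(1) by (intro card_mono) auto
      thus ?thesis using True by simp
    next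
      case False
      have "card S < m" if "closed_in E U S" "2 * card S \<le> n" for S
        using False that unfolding B_def by (metis (mono_tags, lifting) mem_Collect_eq not_le)
      from card_in_small_closed[OF finU this m] show ?thesis using False by simp
    qed
  qed
  also have "\<dots> = real m + real n * measure_pmf.prob M B"
    by (simp add: int)
  also have "\<dots> \<le> real m + real n * cut_bound m"
    using prob_large_closed[OF U] by (intro add_left_mono mult_left_mono) (auto simp: B_def)
  finally show ?thesis .
qed

text \<open>
  For fixed \<open>v\<close> and \<open>u\<close> the graph on the other vertices does not depend on \<open>w\<close>, so by
  independence the sum over \<open>w\<close> is \<open>pendant_prob\<close> times the expected number of vertices
  in small closed sets of one and the same random graph.
\<close>

lemma expectation_small_pendant_count:
  assumes m: "4 * m \<le> n"
  shows "measure_pmf.expectation M small_pendant_count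
    \<le> real (n * (n - 1)) * (pendant_prob * (real m + real n * cut_bound m))"
proof -
  have q: "pendant_prob \<ge> 0" using p by (simp add: pendant_prob_def)
  have "measure_pmf.expectation M small_pendant_count
      = (\<Sum>t\<in>triples n. measure_pmf.prob M {E. case t of (v, u, w) \<Rightarrow>
            pendant E v u w \<and> in_small_closed E ({..<n} - {v, u}) n w})"
    unfolding small_pendant_count_def by (rule expectation_card_pmf[OF fin_M finite_triples])
  also have "\<dots> = (\<Sum>(v, u, w)\<in>triples n.
      pendant_prob * measure_pmf.prob M {E. in_small_closed E ({..<n} - {v, u}) n w})"
  proof (rule sum.cong[OF refl])
    fix t assume t: "t \<in> triples n"
    obtain v u w where vuw: "t = (v, u, w)" by (cases t)
    have "measure_pmf.prob M {E. pendant E v u w \<and> in_small_closed E ({..<n} - {v, u}) n w}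
        = pendant_prob * measure_pmf.prob M {E. in_small_closed E ({..<n} - {v, u}) n w}"
    proof (rule prob_pendant_indep)
      show "{e. e \<subseteq> {..<n} - {v, u}} \<inter> incident_edges n {v, u} = {}"
        by (auto simp: incident_edges_def)
      show "in_small_closed X ({..<n} - {v, u}) n w \<longleftrightarrow> in_small_closed Y ({..<n} - {v, u}) n w"
        if "X \<inter> {e. e \<subseteq> {..<n} - {v, u}} = Y \<inter> {e. e \<subseteq> {..<n} - {v, u}}" for X Y
        using that by (rule in_small_closed_restrict)
      show "(v, u, w) \<in> triples n" using t vuw by simp
    qed
    thus "measure_pmf.prob M {E. case t of (v, u, w) \<Rightarrow>
            pendant E v u w \<and> in_small_closed E ({..<n} - {v, u}) n w}
       = (case t of (v, u, w) \<Rightarrow>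
            pendant_prob * measure_pmf.prob M {E. in_small_closed E ({..<n} - {v, u}) n w})"
      by (simp add: vuw)
  qed
  also have "\<dots> = (\<Sum>(v, u)\<in>(SIGMA v:{..<n}. {..<n} - {v}). pendant_prob *
      (\<Sum>w\<in>{..<n} - {v, u}. measure_pmf.prob M {E. in_small_closed E ({..<n} - {v, u}) n w}))"
    unfolding sum_triples by (simp add: sum_distrib_left)
  also have "\<dots> \<le> (\<Sum>(v, u)\<in>(SIGMA v:{..<n}. {..<n} - {v}). pendant_prob * (real m + real n * cut_bound m))"
  proof (rule sum_mono)
    fix x assume x: "x \<in> (SIGMA v:{..<n}. {..<n} - {v})"
    obtain v u where vu: "x = (v, u)" by (cases x)
    have "card ({..<n} - {v, u}) = n - card {v, u}"
      using x vu by (subst card_Diff_subset) auto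
    hence "n \<le> card ({..<n} - {v, u}) + 2" using x vu by auto
    from sum_prob_in_small_closed[OF _ this m]
    have "(\<Sum>w\<in>{..<n} - {v, u}. measure_pmf.prob M {E. in_small_closed E ({..<n} - {v, u}) n w})
        \<le> real m + real n * cut_bound m" by auto
    thus "(case x of (v, u) \<Rightarrow> pendant_prob *
        (\<Sum>w\<in>{..<n} - {v, u}. measure_pmf.prob M {E. in_small_closed E ({..<n} - {v, u}) n w}))
      \<le> (case x of (v, u) \<Rightarrow> pendant_prob * (real m + real n * cut_bound m))"
      using q by (simp add: vu mult_left_mono)
  qed
  also have "\<dots> = real (card (SIGMA v:{..<n}. {..<n} - {v})) * (pendant_prob * (real m + real n * cut_bound m))"
    by (simp add: case_prod_unfold)
  finally show ?thesis by (simp only: card_pairs)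
qed

lemma pendant_prob_pos: "pendant_prob > 0"
  using p by (simp add: pendant_prob_def)

lemma prob_pendant_count_le_small:
  assumes n: "4 \<le> n" and m: "4 * m \<le> n"
  defines "\<mu> \<equiv> real (n * (n - 1) * (n - 2)) * pendant_prob"
  shows "measure_pmf.prob M {E. pendant_count E \<le> small_pendant_count E}
    \<le> 4 * (3 / \<mu> + 1 / (1 - p) ^ 4 - 1) + 2 * ((real m + real n * cut_bound m) / real (n - 2))"
proof -
  have \<mu>: "measure_pmf.expectation M pendant_count = \<mu>"
    by (simp add: \<mu>_def expectation_pendant_count)
  have pos: "\<mu> > 0" unfolding \<mu>_def using n pendant_prob_pos by simp
  show ?thesis
  proof (rule prob_le_by_second_moment[OF fin_M])
    show "measure_pmf.expectation M pendant_count > 0" unfolding \<mu> by (rule pos)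
    have "3 * \<mu> + \<mu>\<^sup>2 / (1 - p) ^ 4 = (1 + (3 / \<mu> + 1 / (1 - p) ^ 4 - 1)) * \<mu>\<^sup>2"
      using pos by (simp add: field_simps power2_eq_square)
    thus "measure_pmf.expectation M (\<lambda>E. (pendant_count E)\<^sup>2)
        \<le> (1 + (3 / \<mu> + 1 / (1 - p) ^ 4 - 1)) * (measure_pmf.expectation M pendant_count)\<^sup>2"
      using expectation_pendant_count_square[OF n] unfolding \<mu> by simp
    show "small_pendant_count E \<ge> 0" for E by (simp add: small_pendant_count_def)
    have "real (n * (n - 1)) * (pendant_prob * (real m + real n * cut_bound m))
        = (real m + real n * cut_bound m) / real (n - 2) * \<mu>"
      using n by (simp add: \<mu>_def)
    thus "measure_pmf.expectation M small_pendant_count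
        \<le> (real m + real n * cut_bound m) / real (n - 2) * measure_pmf.expectation M pendant_count"
      using expectation_small_pendant_count[OF m] unfolding \<mu> by simp
  qed
qed

lemma spectral_lambda_if_many_pendants:
  assumes E: "E \<subseteq> possible_edges n" and less: "small_pendant_count E < pendant_count E"
    and H: "largest_component (with_proj (graph_of_edges n E)) H"
  shows "spectral_lambda H \<ge> 1 / 2"
proof -
  let ?P = "\<lambda>t. case t of (v, u, w) \<Rightarrow> pendant E v u w"
  let ?S = "\<lambda>t. case t of (v, u, w) \<Rightarrow> pendant E v u w \<and> in_small_closed E ({..<n} - {v, u}) n w"
  have "\<not> {t \<in> triples n. ?P t} \<subseteq> {t \<in> triples n. ?S t}"
  proof
    assume "{t \<in> triples n. ?P t} \<subseteq> {t \<in> triples n. ?S t}"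
    hence "card {t \<in> triples n. ?P t} \<le> card {t \<in> triples n. ?S t}"
      by (intro card_mono) auto
    thus False using less by (simp add: pendant_count_def small_pendant_count_def)
  qed
  then obtain v u w where t: "(v, u, w) \<in> triples n" "pendant E v u w"
    "\<not> in_small_closed E ({..<n} - {v, u}) n w" by auto
  have "\<not> in_small_closed E {..<n} n w"
    using t(3) in_small_closed_delete[of E "{..<n}" n w "{v, u}"] t(1) by (auto simp: mem_triples)
  from spectral_lambda_largest_component[OF E t(2) this H] show ?thesis .
qed

lemma prob_spectral_lambda:
  assumes n: "4 \<le> n" and m: "4 * m \<le> n"
  defines "\<mu> \<equiv> real (n * (n - 1) * (n - 2)) * pendant_prob"
  shows "measure_pmf.prob (gnp n p) {G. \<forall>H. largest_component (with_proj G) H \<longrightarrow> spectral_lambda H \<ge> 1 / 2}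
    \<ge> 1 - (4 * (3 / \<mu> + 1 / (1 - p) ^ 4 - 1) + 2 * ((real m + real n * cut_bound m) / real (n - 2)))"
proof -
  let ?good = "{G. \<forall>H. largest_component (with_proj G) H \<longrightarrow> spectral_lambda H \<ge> 1 / 2}"
  let ?bad = "{E. pendant_count E \<le> small_pendant_count E}"
  have "gnp n p = map_pmf (graph_of_edges n) M"
    by (simp add: gnp_def random_subset_def map_pmf_comp)
  hence "measure_pmf.prob (gnp n p) ?good = measure_pmf.prob M (graph_of_edges n -` ?good)"
    by (simp add: measure_map_pmf)
  also have "\<dots> \<ge> measure_pmf.prob M (- ?bad)"
  proof -
    have "measure_pmf.prob M (- ?bad) = measure_pmf.prob M (- ?bad \<inter> set_pmf M)"
      by (simp only: measure_Int_set_pmf)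
    also have "\<dots> \<le> measure_pmf.prob M (graph_of_edges n -` ?good)"
    proof (rule measure_pmf.finite_measure_mono)
      show "- ?bad \<inter> set_pmf M \<subseteq> graph_of_edges n -` ?good"
      proof
        fix E assume E: "E \<in> - ?bad \<inter> set_pmf M"
        hence "E \<subseteq> possible_edges n" using set_random_subset by blast
        moreover have "small_pendant_count E < pendant_count E" using E by auto
        ultimately show "E \<in> graph_of_edges n -` ?good"
          using spectral_lambda_if_many_pendants by auto
      qed
    qed simp
    finally show ?thesis .
  qed
  also have "measure_pmf.prob M (- ?bad) = 1 - measure_pmf.prob M ?bad"
    using measure_pmf.prob_compl[of ?bad M] by (simp add: Compl_eq_Diff_UNIV)
  finally show ?thesis
    using prob_pendant_count_le_small[OF n m] by (simp add: \<mu>_def)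
qed

end

section \<open>Asymptotics\<close>

context random_edges
begin

text \<open>
  The exponent of \<open>1 - p\<close> is at least \<open>n\<^sup>2 / (8 k)\<close>, so that the failure probability of a single set
  is at most \<open>exp (- n (n p) / (8 k)) \<le> exp (- 2 n)\<close>. This beats the number \<open>2\<^sup>n\<close> of sets.
\<close>

lemma cut_bound_le:
  assumes k: "0 < k" and n: "k \<le> n" "10 \<le> n" and c: "16 * real k \<le> real n * p"
  shows "cut_bound (n div k) \<le> exp (- real n)"
proof -
  let ?m = "n div k" and ?h = "n div 2 - 2"
  have "n \<le> 2 * k * ?m"
  proof -
    have "?m > 0" using k n by (simp add: div_greater_zero_iff)
    hence "k \<le> k * ?m" by simp
    moreover have "n < k * ?m + k" using k by (metis add.commute dividend_less_times_div mult.commute)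
    ultimately show ?thesis by linarith
  qed
  moreover have "n \<le> 4 * ?h" using n(2) by linarith
  ultimately have "n * n \<le> (2 * k * ?m) * (4 * ?h)" by (rule mult_le_mono)
  hence "n * n \<le> 8 * k * (?m * ?h)" by (simp add: mult_ac)
  hence "real (n * n) \<le> real (8 * k * (?m * ?h))" by (rule of_nat_mono)
  hence "p * (real n * real n) \<le> p * (8 * real k * real (?m * ?h))"
    using p by (intro mult_left_mono) auto
  moreover have "16 * real k * real n \<le> real n * p * real n"
    using c by (intro mult_right_mono) auto
  ultimately have "8 * real k * (2 * real n) \<le> 8 * real k * (p * real (?m * ?h))"
    by (simp add: mult_ac)
  hence exponent: "2 * real n \<le> p * real (?m * ?h)"
    by (rule mult_left_le_imp_le) (use k in simp)
  have "(2::real) \<le> exp 1" using exp_ge_add_one_self[of "1::real"] by linarith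
  hence "(2::real) ^ n \<le> exp 1 ^ n" by (intro power_mono) auto
  also have "\<dots> = exp (real n)" by (simp flip: exp_of_nat_mult)
  finally have two: "(2::real) ^ n \<le> exp (real n)" .
  have "1 - p \<le> exp (- p)" using exp_ge_add_one_self[of "- p"] by simp
  hence "(1 - p) ^ (?m * ?h) \<le> exp (- p) ^ (?m * ?h)" using p by (intro power_mono) auto
  also have "\<dots> = exp (- (p * real (?m * ?h)))" by (simp add: mult.commute flip: exp_of_nat_mult)
  also have "\<dots> \<le> exp (- (2 * real n))" using exponent by simp
  finally have "cut_bound ?m \<le> exp (real n) * exp (- (2 * real n))"
    unfolding cut_bound_def using two p by (intro mult_mono) auto
  also have "\<dots> = exp (- real n)" by (simp flip: exp_add)
  finally show ?thesis .
qed

text \<open>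
  From \<open>ln (1 - p) \<ge> - p - 2 p\<^sup>2\<close> the probability \<open>(1 - p)\<^bsup>2 n\<^esup>\<close> is at least
  \<open>exp (- 2 n p) exp (- 4 n p\<^sup>2)\<close>. The first factor is at least \<open>1 / n\<close> because
  \<open>2 n p \<le> log n\<close>, and the second one is at least \<open>exp (- 1)\<close>.
\<close>

lemma mean_pendant_count_ge:
  assumes n: "4 \<le> n" and half: "p \<le> 1 / 2" and c: "2 * real n * p \<le> ln (real n)" and small: "4 * real n * p\<^sup>2 \<le> 1"
  shows "(real n * p)\<^sup>2 / (4 * exp 1) \<le> real (n * (n - 1) * (n - 2)) * pendant_prob"
proof -
  have "- p - 2 * p\<^sup>2 \<le> ln (1 - p)" using p half by (intro ln_one_minus_pos_lower_bound) auto
  hence "exp (- p - 2 * p\<^sup>2) \<le> 1 - p" using p by (subst ln_ge_iff[symmetric]) auto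
  hence "exp (- p - 2 * p\<^sup>2) ^ (2 * n) \<le> (1 - p) ^ (2 * n)" by (intro power_mono) auto
  also have "\<dots> \<le> (1 - p) ^ (2 * n - 5)" using p by (intro power_decreasing) auto
  finally have pw: "exp (- p - 2 * p\<^sup>2) ^ (2 * n) \<le> (1 - p) ^ (2 * n - 5)" .
  have "exp (- p - 2 * p\<^sup>2) ^ (2 * n) = exp (- (2 * real n * p) - 4 * real n * p\<^sup>2)"
    by (simp add: algebra_simps flip: exp_of_nat_mult)
  moreover have "exp (- ln (real n) - 1) \<le> exp (- (2 * real n * p) - 4 * real n * p\<^sup>2)"
    using c small by simp
  moreover have "exp (- ln (real n) - 1) = 1 / (real n * exp 1)"
    using n by (simp add: exp_diff exp_minus field_simps)
  ultimately have low: "1 / (real n * exp 1) \<le> (1 - p) ^ (2 * n - 5)" using pw by simp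
  have nat: "n * n * n \<le> 4 * (n * (n - 1) * (n - 2))"
  proof -
    have "n * n \<le> (2 * (n - 1)) * (2 * (n - 2))" using n by (intro mult_le_mono) auto
    hence "n * (n * n) \<le> n * ((2 * (n - 1)) * (2 * (n - 2)))" by (rule mult_le_mono2)
    thus ?thesis by (simp add: mult_ac)
  qed
  hence "real (n * n * n) \<le> real (4 * (n * (n - 1) * (n - 2)))" by (rule of_nat_mono)
  hence cube: "real n ^ 3 / 4 \<le> real (n * (n - 1) * (n - 2))" by (simp add: power3_eq_cube)
  have "(real n * p)\<^sup>2 / (4 * exp 1) = real n ^ 3 / 4 * (p\<^sup>2 * (1 / (real n * exp 1)))"
    using n by (simp add: field_simps power2_eq_square power3_eq_cube)
  also have "\<dots> \<le> real (n * (n - 1) * (n - 2)) * (p\<^sup>2 * (1 - p) ^ (2 * n - 5))"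
    using cube low by (intro mult_mono) auto
  finally show ?thesis by (simp only: pendant_prob_def)
qed

end

lemma mean_degree_at_top:
  fixes p :: "nat \<Rightarrow> real"
  assumes nonneg: "\<And>n. 0 \<le> p n" and omega: "p \<in> \<omega>(\<lambda>n. sqrt (ln (real n)) / real n)"
  shows "filterlim (\<lambda>n. real n * p n) at_top sequentially"
  unfolding filterlim_at_top
proof
  fix Z :: real
  define C where "C = max Z 1"
  have "eventually (\<lambda>n. C * norm (sqrt (ln (real n)) / real n) \<le> norm (p n)) sequentially"
    using landau_omega.smallD[OF omega, of C] by (simp add: C_def)
  moreover have "eventually (\<lambda>n. ln (real n) \<ge> 1 \<and> n > 0) sequentially"
    by (intro eventually_conj eventually_gt_at_top) real_asymp
  ultimately show "eventually (\<lambda>n. Z \<le> real n * p n) sequentially"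
  proof eventually_elim
    case (elim n)
    have "Z \<le> C * 1" by (simp add: C_def)
    also have "\<dots> \<le> C * sqrt (ln (real n))" using elim by (intro mult_left_mono) (auto simp: C_def)
    also have "\<dots> \<le> real n * p n" using elim nonneg[of n] by (simp add: field_simps)
    finally show ?case .
  qed
qed

theorem theorem1p2:
  fixes p :: "nat \<Rightarrow> real"
  assumes "\<And>n. 0 \<le> p n \<and> p n \<le> 1"
    and "p \<in> \<omega>(\<lambda>n. sqrt (ln (real n)) / real n)"
    and "\<forall>\<^sub>F n in sequentially. p n \<le> 1/2 * ln (real n) / real n"
  shows "(\<lambda>n. measure_pmf.prob (gnp n (p n))
            {G. \<forall>H. largest_component (with_proj G) H \<longrightarrow> spectral_lambda H \<ge> 1/2})
         \<longlonglongrightarrow> 1"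
proof -
  define P where "P = (\<lambda>n. measure_pmf.prob (gnp n (p n))
            {G. \<forall>H. largest_component (with_proj G) H \<longrightarrow> spectral_lambda H \<ge> 1/2})"
  define \<mu> where "\<mu> = (\<lambda>n. real (n * (n - 1) * (n - 2)) * random_edges.pendant_prob n (p n))"
  have deg: "filterlim (\<lambda>n. real n * p n) at_top sequentially"
    using assms(1,2) by (intro mean_degree_at_top) auto
  have deg_gt: "eventually (\<lambda>n. C \<le> real n * p n) sequentially" for C
    using deg by (simp add: filterlim_at_top)
  have p0: "p \<longlonglongrightarrow> 0"
  proof (rule tendsto_sandwich[OF _ assms(3) tendsto_const])
    show "eventually (\<lambda>n. 0 \<le> p n) sequentially" using assms(1) by simp
    show "(\<lambda>n. 1/2 * ln (real n) / real n) \<longlonglongrightarrow> 0" by real_asymp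
  qed
  have half: "eventually (\<lambda>n. p n < 1 / 2) sequentially"
    using order_tendstoD(2)[OF p0, of "1 / 2"] by simp
  have pos: "eventually (\<lambda>n. random_edges (p n)) sequentially"
    using deg_gt[of 1] half
  proof eventually_elim
    case (elim n)
    hence "p n \<noteq> 0" by auto
    thus ?case using elim assms(1)[of n] by unfold_locales auto
  qed
  have small: "eventually (\<lambda>n. 4 * real n * (p n)\<^sup>2 \<le> 1) sequentially"
  proof -
    have "eventually (\<lambda>n. (ln (real n))\<^sup>2 / real n \<le> 1) sequentially" by real_asymp
    thus ?thesis using assms(3) eventually_gt_at_top[of 0]
    proof eventually_elim
      case (elim n)
      have "(p n)\<^sup>2 \<le> (1/2 * ln (real n) / real n)\<^sup>2" using elim assms(1)[of n] by (intro power_mono) auto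
      hence "4 * real n * (p n)\<^sup>2 \<le> 4 * real n * (1/2 * ln (real n) / real n)\<^sup>2"
        by (intro mult_left_mono) auto
      also have "\<dots> = (ln (real n))\<^sup>2 / real n" using elim by (simp add: field_simps power2_eq_square)
      finally show ?case using elim(1) by linarith
    qed
  qed
  have \<mu>: "filterlim \<mu> at_top sequentially"
  proof (rule filterlim_at_top_mono)
    have "filterlim (\<lambda>n. (real n * p n)\<^sup>2 * (1 / (4 * exp 1))) at_top sequentially"
      by (rule filterlim_at_top_mult_tendsto_pos[OF tendsto_const _ filterlim_pow_at_top[OF _ deg]]) auto
    thus "filterlim (\<lambda>n. (real n * p n)\<^sup>2 / (4 * exp 1)) at_top sequentially" by simp
    show "eventually (\<lambda>n. (real n * p n)\<^sup>2 / (4 * exp 1) \<le> \<mu> n) sequentially"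
      using pos half small assms(3) eventually_ge_at_top[of 4]
    proof eventually_elim
      case (elim n)
      thus ?case unfolding \<mu>_def
        by (intro random_edges.mean_pendant_count_ge) (auto simp: field_simps)
    qed
  qed
  (* The error terms that vanish for every choice of k. *)
  define A where "A = (\<lambda>n. 4 * (3 / \<mu> n + 1 / (1 - p n) ^ 4 - 1) + 4 * exp (- real n))"
  have "A \<longlonglongrightarrow> 4 * (0 + 1 / (1 - 0) ^ 4 - 1) + 4 * 0"
    unfolding A_def
  proof (intro tendsto_intros p0)
    show "(\<lambda>n. 3 / \<mu> n) \<longlonglongrightarrow> 0"
      by (rule tendsto_divide_0[OF tendsto_const filterlim_at_top_imp_at_infinity[OF \<mu>]])
    show "(\<lambda>n. exp (- real n)) \<longlonglongrightarrow> 0" by real_asymp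
  qed simp
  hence A: "A \<longlonglongrightarrow> 0" by simp
  have bound: "eventually (\<lambda>n. 1 - (A n + 4 / real k) \<le> P n) sequentially" if k: "4 \<le> k" for k
    using pos deg_gt[of "16 * real k"] eventually_ge_at_top[of "max k 10"]
  proof eventually_elim
    case (elim n)
    interpret random_edges n "p n" by (rule elim(1))
    (* Closed sets with between n / k and n / 2 vertices are excluded by the union bound. *)
    define m where "m = n div k"
    have n: "k \<le> n" "10 \<le> n" using elim(3) by auto
    have "4 * m \<le> k * m" using k by simp
    also have "\<dots> \<le> n" by (simp add: m_def)
    finally have "4 * m \<le> n" .
    have cut: "cut_bound m \<le> exp (- real n)"
      unfolding m_def using elim(2) n k by (intro cut_bound_le) auto
    have "real m \<le> real n / real k" unfolding m_def by (rule of_nat_div_le_of_nat)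
    moreover have "real n * cut_bound m \<le> real n * exp (- real n)"
      using cut by (intro mult_left_mono) auto
    ultimately have "real m + real n * cut_bound m \<le> real n * (1 / real k + exp (- real n))"
      by (simp add: distrib_left)
    also have "\<dots> \<le> (2 * real (n - 2)) * (1 / real k + exp (- real n))"
      using n by (intro mult_right_mono) auto
    also have "\<dots> = 2 * (1 / real k + exp (- real n)) * real (n - 2)" by (simp only: mult_ac)
    finally have "(real m + real n * cut_bound m) / real (n - 2) \<le> 2 * (1 / real k + exp (- real n))"
      using n by (subst pos_divide_le_eq) auto
    moreover have "1 - (4 * (3 / \<mu> n + 1 / (1 - p n) ^ 4 - 1)
        + 2 * ((real m + real n * cut_bound m) / real (n - 2))) \<le> P n"
      unfolding P_def \<mu>_def using n by (intro prob_spectral_lambda \<open>4 * m \<le> n\<close>) simp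
    ultimately show "1 - (A n + 4 / real k) \<le> P n"
      unfolding A_def by argo
  qed
  have "P \<longlonglongrightarrow> 1"
  proof (rule order_tendstoI)
    fix a :: real assume "a < 1"
    (* With this k the pendant paths at small closed sets cost at most 4 / k <= (1 - a) / 2. *)
    define k where "k = nat \<lceil>8 / (1 - a)\<rceil> + 4"
    have k: "4 \<le> k" "8 / (1 - a) \<le> real k" unfolding k_def by simp linarith
    hence "8 \<le> (1 - a) * real k" using \<open>a < 1\<close> by (simp add: divide_le_eq mult.commute)
    hence quarter: "4 / real k \<le> (1 - a) / 2" using k(1) by (simp add: divide_le_eq)
    have "eventually (\<lambda>n. A n < (1 - a) / 2) sequentially"
      by (rule order_tendstoD(2)[OF A]) (use \<open>a < 1\<close> in simp)
    with bound[OF k(1)] show "eventually (\<lambda>n. a < P n) sequentially"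
      by eventually_elim (use quarter in argo)
  next
    fix a :: real assume "1 < a"
    thus "eventually (\<lambda>n. P n < a) sequentially"
      unfolding P_def by (intro always_eventually allI) (meson le_less_trans measure_pmf.prob_le_1)
  qed
  thus ?thesis unfolding P_def .
qed

end
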